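(* Let $h=1$, let $X$ be an upwards skip-free Lévy chain on $\mathbb{Z}$ with Lévy measure $\lambda$, and let $q\ge0$. Let $P$ be the transition matrix associated to the jump chain of $X$ and $\lambda_q:=1+q/\lambda(\mathbb{R})$. Seen as vectors, $W^{(q)}:=(W^{(q)}(k))_{k\in\mathbb{Z}}$ and $Z^{(q)}:=(Z^{(q)}(k))_{k\in\mathbb{Z}}$ satisfy, entry-by-entry, $$(PW^{(q)})|_{\mathbb{Z}_+}=\lambda_qW^{(q)}|_{\mathbb{Z}_+}\quad\text{and}\quad(PZ^{(q)})|_{\mathbb{Z}_+}=\lambda_qZ^{(q)}|_{\mathbb{Z}_+},$$ i.e., with $\gamma:=\lambda(\mathbb{R})$, $p:=\lambda(\{1\})/\gamma$ and $q_l:=\lambda(\{-l\})/\gamma$ ($l\ge1$), for all $k\in\mathbb{Z}_+$: $$pW^{(q)}(k+1)=\left(1+\frac q\gamma\right)W^{(q)}(k)-\sum_{l=1}^kq_lW^{(q)}(k-l)$$ and $$pZ^{(q)}(k+1)+\left(1-p-\sum_{l=1}^{k-1}q_l\right)=\left(1+\frac q\gamma\right)Z^{(q)}(k)-\sum_{l=1}^{k-1}q_lZ^{(q)}(k-l).$$ Additionally, $W^{(q)}(k)=0$ for all negative integers $k$ and $W^{(q)}(0)=1/\lambda(\{1\})$, whereas $Z^{(q)}(k)=1$ for all nonpositive integers $k$.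
   Context: $\mathbb{Z}_+=\{0,1,2,\dots\}$; empty sums are $0$. $X$ is an upwards skip-free Lévy chain on $\mathbb{Z}$: a Lévy process (càdlàg paths, $X_0=0$ a.s.) that is compound Poisson (finite Lévy measure $\lambda$, no drift, no Gaussian part) with $\lambda$ supported in $\mathbb{Z}$ and with $\lambda|_{(0,\infty)}$ having support exactly $\{1\}$ (so $\lambda(\{1\})>0$). The jump chain is the random walk on $\mathbb{Z}$ of successive positions of $X$; its transition matrix is $P_{k,m}=\lambda(\{m-k\})/\lambda(\mathbb{R})$, $k,m\in\mathbb{Z}$. $\psi(\beta)=\int_{\mathbb{R}}(e^{\beta x}-1)\lambda(dx)$, $\beta\ge0$, is the Laplace exponent; it is strictly convex and continuous on $[0,\infty)$ and tends to $+\infty$; $\Phi(0)$ is the largest root of $\psi|_{[0,\infty)}$, and $\Phi:[0,\infty)\to[\Phi(0),\infty)$ is the inverse of the increasing bijection $\psi:[\Phi(0),\infty)\to[0,\infty)$. Scale functions (with $h=1$): with $T_1:=\inf\{t\ge0:X_t\ge1\}$ and $D_1:=-\inf\{X_s:0\le s\le T_1,\ s<\infty\}$, the scale function of $X$ is $W(x)=c/\prod_{r=1}^{\lfloor x\rfloor}\mathsf{P}(D_1\le r-1)$, $x\ge0$, where $c>0$ is chosen so that $\int_0^\infty e^{-\beta x}W(x)\,dx=\frac{e^\beta-1}{\beta\psi(\beta)}$ for $\beta>\Phi(0)$. For $b\ge0$, $W_b$ denotes the scale function (defined in the same way, with the same normalization relative to its own Laplace exponent) of the upwards skip-free Lévy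 chain with Lévy measure $e^{bx}\lambda(dx)$, whose Laplace exponent is $\psi(\cdot+b)-\psi(b)$. For $q\ge0$ and $x\ge0$, $W^{(q)}(x):=e^{\Phi(q)\lfloor1+x\rfloor}W_{\Phi(q)}(x)$ and $Z^{(q)}(x):=1+q\int_0^{\lfloor x\rfloor}W^{(q)}(z)\,dz$; on $(-\infty,0)$ these are extended by $W^{(q)}:=0$ and $Z^{(q)}:=1$. *)

theory Defs
  imports "HOL-Probability.Probability"
begin

definition cadlag :: "(real \<Rightarrow> real) \<Rightarrow> bool" where
  "cadlag f \<longleftrightarrow> (\<forall>t\<ge>0. (f \<longlongrightarrow> f t) (at_right t)) \<and>
                (\<forall>t>0. \<exists>l. (f \<longlongrightarrow> l) (at_left t))"

text \<open>Processes are indexed by all reals; only times \<open>t \<ge> 0\<close> matter.\<close>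

locale levy_process = prob_space M for M :: "'a measure" +
  fixes X :: "real \<Rightarrow> 'a \<Rightarrow> real"
  assumes meas: "\<And>t. 0 \<le> t \<Longrightarrow> X t \<in> borel_measurable M"
    and cadlag_paths: "AE \<omega> in M. cadlag (\<lambda>t. X t \<omega>)"
    and start: "AE \<omega> in M. X 0 \<omega> = 0"
    and indep_increments: "\<And>(t :: nat \<Rightarrow> real) n. 0 \<le> t 0 \<Longrightarrow> mono t \<Longrightarrow>
          indep_vars (\<lambda>_. borel) (\<lambda>i \<omega>. X (t (Suc i)) \<omega> - X (t i) \<omega>) {..<n}"
    and stationary_increments: "\<And>s t. 0 \<le> s \<Longrightarrow> 0 \<le> t \<Longrightarrow>
          distr M borel (\<lambda>\<omega>. X (s + t) \<omega> - X s \<omega>) = distr M borel (X t)"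

text \<open>Topological support, relative to the space of the measure.\<close>

definition measure_support :: "'a::topological_space measure \<Rightarrow> 'a set" where
  "measure_support \<mu> =
     {x \<in> space \<mu>. \<forall>U. open U \<and> x \<in> U \<longrightarrow> 0 < emeasure \<mu> (U \<inter> space \<mu>)}"

text \<open>Compound Poisson with L\'evy measure \<open>lam\<close>: the characteristic exponent is
  \<open>u \<mapsto> \<integral> (exp (i u x) - 1) lam(dx)\<close>, so there is neither drift nor Gaussian part.\<close>

locale usf_levy_chain = levy_process M X
  for M :: "'a measure" and X :: "real \<Rightarrow> 'a \<Rightarrow> real" +
  fixes lam :: "real measure"
  assumes lam_borel: "sets lam = sets borel"
    and lam_finite: "finite_measure lam"
    and lam_zero: "emeasure lam {0} = 0"
    and char_exponent: "\<And>t u. 0 \<le> t \<Longrightarrow>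
          char (distr M borel (X t)) u
            = exp (complex_of_real t * (LINT x|lam. iexp (u * x) - 1))"
    and lam_support: "measure_support lam \<subseteq> \<int>"
    and lam_support_pos: "measure_support (restrict_space lam {0<..}) = {1}"

definition laplace_exponent :: "real measure \<Rightarrow> real \<Rightarrow> real" where
  "laplace_exponent lam \<beta> = (LINT x|lam. exp (\<beta> * x) - 1)"

definition largest_root :: "real measure \<Rightarrow> real" where
  "largest_root lam = (GREATEST \<beta>. 0 \<le> \<beta> \<and> laplace_exponent lam \<beta> = 0)"

definition Phi :: "real measure \<Rightarrow> real \<Rightarrow> real" where
  "Phi lam = the_inv_into {largest_root lam..} (laplace_exponent lam)"

definition tilt :: "real \<Rightarrow> real measure \<Rightarrow> real measure" where
  "tilt b lam = density lam (\<lambda>x. ennreal (exp (b * x)))"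

definition T1 :: "(real \<Rightarrow> 'a \<Rightarrow> real) \<Rightarrow> 'a \<Rightarrow> ereal" where
  "T1 X \<omega> = Inf {ereal t | t. 0 \<le> t \<and> 1 \<le> X t \<omega>}"

definition D1 :: "(real \<Rightarrow> 'a \<Rightarrow> real) \<Rightarrow> 'a \<Rightarrow> ereal" where
  "D1 X \<omega> = - Inf {ereal (X s \<omega>) | s. 0 \<le> s \<and> ereal s \<le> T1 X \<omega>}"

text \<open>The event \<open>D\<^sub>1 \<le> x\<close> involves uncountably many times and need only be measurable up to a
  null set (paths may be irregular or leave the integers there), hence the completion of \<open>M\<close>.\<close>

definition prob_D1_le :: "'a measure \<Rightarrow> (real \<Rightarrow> 'a \<Rightarrow> real) \<Rightarrow> real \<Rightarrow> real" where
  "prob_D1_le M X x = measure (completion M) {\<omega> \<in> space M. D1 X \<omega> \<le> ereal x}"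

definition unnormalized_scale :: "'a measure \<Rightarrow> (real \<Rightarrow> 'a \<Rightarrow> real) \<Rightarrow> real \<Rightarrow> real" where
  "unnormalized_scale M X x = 1 / (\<Prod>r = 1..nat \<lfloor>x\<rfloor>. prob_D1_le M X (real r - 1))"

definition scale_const ::
    "'a measure \<Rightarrow> (real \<Rightarrow> 'a \<Rightarrow> real) \<Rightarrow> real measure \<Rightarrow> real" where
  "scale_const M X lam = (THE c. 0 < c \<and>
     (\<forall>\<beta>>largest_root lam.
        ((\<lambda>x. exp (- \<beta> * x) * (c * unnormalized_scale M X x)) has_integral
           (exp \<beta> - 1) / (\<beta> * laplace_exponent lam \<beta>)) {0..}))"

text \<open>The scale function, for arguments \<open>x \<ge> 0\<close>, of the chain \<open>X\<close> with L\'evy measure \<open>lam\<close>.\<close>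

definition scale_function ::
    "'a measure \<Rightarrow> (real \<Rightarrow> 'a \<Rightarrow> real) \<Rightarrow> real measure \<Rightarrow> real \<Rightarrow> real" where
  "scale_function M X lam x = scale_const M X lam * unnormalized_scale M X x"

text \<open>Here \<open>Y\<close> (on \<open>N\<close>) is meant to be an upwards skip-free L\'evy chain with the tilted L\'evy
  measure \<open>tilt (Phi lam q) lam\<close>. As the scale function depends only on the law of the chain,
  the choice of \<open>N\<close> and \<open>Y\<close> is immaterial.\<close>

definition scale_W ::
    "'b measure \<Rightarrow> (real \<Rightarrow> 'b \<Rightarrow> real) \<Rightarrow> real measure \<Rightarrow> real \<Rightarrow> real \<Rightarrow> real" where
  "scale_W N Y lam q x = (if x < 0 then 0
     else exp (Phi lam q * of_int \<lfloor>1 + x\<rfloor>) * scale_function N Y (tilt (Phi lam q) lam) x)"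

definition scale_Z ::
    "'b measure \<Rightarrow> (real \<Rightarrow> 'b \<Rightarrow> real) \<Rightarrow> real measure \<Rightarrow> real \<Rightarrow> real \<Rightarrow> real" where
  "scale_Z N Y lam q x = (if x < 0 then 1
     else 1 + q * integral {0..of_int \<lfloor>x\<rfloor>} (scale_W N Y lam q))"

definition jump_matrix :: "real measure \<Rightarrow> int \<Rightarrow> int \<Rightarrow> real" where
  "jump_matrix lam k m = measure lam {real_of_int (m - k)} / measure lam UNIV"

end

theory Submission
  imports Defs
begin

text \<open>Observe the chain along the grids of mesh \<open>h = 1 / (k + 1)\<close>. The probability that such a
  skeleton walk, started at \<open>i\<close>, reaches \<open>A\<close> before becoming negative is harmonic for the law of
  \<open>X h\<close>; and on right-continuous integer-valued paths the skeleton events converge to their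
  continuous-time analogues. Fourier inversion on the integers gives
  \<open>P(X h = n) = [n = 0] + h (lam {n} - \<gamma> [n = 0]) + o(h)\<close>, so in the limit the exit probabilities
  satisfy the finite linear system that forces them to be \<open>v i / v A\<close>, where \<open>v\<close> solves
  \<open>lam {1} v (n + 1) = \<gamma> v n - (\<Sum>l\<le>n. lam {-l} v (n - l))\<close> and \<open>v 0 = 1\<close>. This avoids the strong Markov
  property. As \<open>P(D\<^sub>1 \<le> r - 1)\<close> is the case \<open>i = r - 1\<close>, \<open>A = r\<close>, the product in the definition of the
  scale function telescopes to \<open>1 / v\<close>, and the generating function of \<open>v\<close> shows that the
  normalizing constant is \<open>1 / lam {1}\<close>. Applied to the tilted measure, whose total mass is
  \<open>\<gamma> + \<psi> (\<Phi> q) = \<gamma> + q\<close>, this is the recursion for \<open>W\<close>; summing it yields the one for \<open>Z\<close>.\<close>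

section \<open>The Levy measure\<close>

text \<open>Skip-freeness is given only through \<open>lam\<close>, not as a property of paths, so
  it has to re-emerge as \<open>P(X h \<ge> 2) = o(h)\<close>. Fourier inversion yields limits of
  single atoms without uniformity; that tail is therefore estimated through its complement, using
  finitely many atoms that carry almost all of the mass. The grids are not nested, so the skeleton
  events do not converge monotonically. Instead, almost every path is constant for a while after
  each time, hence has the same success or failure as its skeleton on all sufficiently fine grids.
  Positivity and monotonicity of \<open>v\<close>, invisible in a recursion with subtracted terms,
  come from the meaning of its ratios as probabilities; monotonicity in turn makes the generating
  function converge wherever the exponent is positive. The tilt by \<Phi> q moves the largest root
  of the exponent to 0, so the normalization has to be computed only for exponents that are positive
  on all of \<beta> > 0.\<close>

lemma emeasure_open_disjoint_support:
  fixes \<mu> :: "'a::second_countable_topology measure"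
  assumes open_sets: "\<And>V. open V \<Longrightarrow> V \<inter> space \<mu> \<in> sets \<mu>"
    and U: "U \<inter> space \<mu> \<in> sets \<mu>" "U \<inter> measure_support \<mu> = {}"
  shows "emeasure \<mu> (U \<inter> space \<mu>) = 0"
proof -
  define F where "F = {V. open V \<and> emeasure \<mu> (V \<inter> space \<mu>) = 0}"
  \<comment> \<open>The null open sets cover the complement of the support, but there may be
    uncountably many of them; a countable subfamily with the same union keeps the union
    null.\<close>
  obtain F' where F': "F' \<subseteq> F" "countable F'" "\<Union>F' = \<Union>F"
    using Lindelof[of F] by (auto simp: F_def)
  have "U \<inter> space \<mu> \<subseteq> \<Union>F"
  proof
    fix x assume "x \<in> U \<inter> space \<mu>"
    then have "x \<in> space \<mu>" "x \<notin> measure_support \<mu>" using U(2) by auto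
    then obtain V where "open V" "x \<in> V" "emeasure \<mu> (V \<inter> space \<mu>) = 0"
      unfolding measure_support_def by auto
    then show "x \<in> \<Union>F" unfolding F_def by blast
  qed
  then have sub: "U \<inter> space \<mu> \<subseteq> (\<Union>V\<in>F'. V \<inter> space \<mu>)"
    using F'(3) by auto
  have "(\<Union>V\<in>F'. V \<inter> space \<mu>) \<in> null_sets \<mu>"
    using F'(1,2) open_sets by (intro null_sets_UN') (auto simp: F_def null_sets_def)
  from null_sets_subset[OF this U(1) sub] show ?thesis by auto
qed

context usf_levy_chain
begin

sublocale lam: finite_measure lam
  by (rule lam_finite)

lemma space_lam [simp]: "space lam = UNIV"
  using sets_eq_imp_space_eq[OF lam_borel] by simp

lemma sets_lam [measurable_cong, simp]: "sets lam = sets borel"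
  by (rule lam_borel)

lemma lam_positive_part: "emeasure lam ({0<..} - {1}) = 0"
proof -
  let ?R = "restrict_space lam {0<..}"
  have sp: "space ?R = {0<..}" by (simp add: space_restrict_space)
  have "emeasure ?R (({0<..} - {1}) \<inter> space ?R) = 0"
    by (rule emeasure_open_disjoint_support)
       (auto simp: sp sets_restrict_space lam_support_pos)
  then show ?thesis
    by (simp add: sp emeasure_restrict_space Int_absorb2 Diff_subset)
qed

text \<open>Both support hypotheses in pointwise form. In particular \<open>x \<le> 1\<close> almost
  everywhere, which later makes the exponentials integrable.\<close>

lemma AE_lam: "AE x in lam. x = 1 \<or> (\<exists>l::nat. x = - real l)"
proof -
  have "emeasure lam ((- \<int>) \<inter> space lam) = 0"
    by (rule emeasure_open_disjoint_support) (use lam_support in auto)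
  then have 1: "AE x in lam. x \<in> \<int>"
    by (intro AE_I[of _ _ "- \<int>"]) auto
  have 2: "AE x in lam. x \<notin> {0<..} - {1}"
    using lam_positive_part by (intro AE_I[of _ _ "{0<..} - {1}"]) auto
  show ?thesis
    using 1 2
  proof eventually_elim
    case (elim x)
    then obtain n where n: "x = of_int n" by (auto elim: Ints_cases)
    show ?case
    proof (cases "n \<le> 0")
      case True
      then have "x = - real (nat (- n))" using n by simp
      then show ?thesis by blast
    next
      case False
      with n elim show ?thesis by auto
    qed
  qed
qed

text \<open>The neighbourhood \<open>{0<..}\<close> of the support point 1 has positive mass, and
  all of it except 1 itself is null.\<close>

lemma measure_lam_one_pos: "0 < measure lam {1}"
proof -
  let ?R = "restrict_space lam {0<..}"
  have "1 \<in> measure_support ?R" by (simp add: lam_support_pos)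
  then have "0 < emeasure ?R ({0<..} \<inter> space ?R)"
    unfolding measure_support_def by (auto dest!: spec[of _ "{0<..}"])
  then have "0 < emeasure lam {0<..}"
    by (simp add: space_restrict_space emeasure_restrict_space)
  also have "emeasure lam {0<..} = emeasure lam (({0<..} - {1}) \<union> {1})"
    by (rule arg_cong[where f="emeasure lam"]) auto
  also have "\<dots> \<le> emeasure lam ({0<..} - {1}) + emeasure lam {1}"
    by (rule emeasure_subadditive) auto
  finally show ?thesis
    using lam_positive_part by (simp add: lam.emeasure_eq_measure)
qed

lemma measure_lam_zero: "measure lam {0} = 0"
  using lam_zero by (simp add: measure_def)

lemma measure_lam_ge2: "2 \<le> n \<Longrightarrow> measure lam {real_of_int n} = 0"
proof -
  assume "2 \<le> n"
  then have "emeasure lam {real_of_int n} \<le> emeasure lam ({0<..} - {1})"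
    by (intro emeasure_mono) auto
  then show ?thesis using lam_positive_part by (simp add: measure_def)
qed

text \<open>A bound is asked for only on \<open>x \<le> 1\<close>, where \<open>lam\<close> lives:
  this admits \<open>exp (\<beta> * x) - 1\<close> with \<beta> \<ge> 0, which is unbounded on the
  line.\<close>

lemma
  fixes f :: "real \<Rightarrow> real"
  assumes f: "f \<in> borel_measurable borel" and bd: "\<And>x. x \<le> 1 \<Longrightarrow> \<bar>f x\<bar> \<le> B"
  shows integrable_lam: "integrable lam f"
    and integral_lam_sums:
      "(\<lambda>l. f (- real l) * measure lam {- real l}) sums ((LINT x|lam. f x) - f 1 * measure lam {1})"
proof -
  have fl[measurable]: "f \<in> borel_measurable lam" using f by (simp add: measurable_def)
  show int: "integrable lam f"
  proof (rule lam.integrable_const_bound[where B=B])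
    show "AE x in lam. norm (f x) \<le> B"
      using AE_lam by eventually_elim (auto intro!: bd)
  qed simp
  \<comment> \<open>Finite sets exhausting the atoms: on each the integral is a finite sum, and
    dominated convergence with |f| passes to the whole measure.\<close>
  define A where "A n = insert 1 ((\<lambda>l. - real l) ` {..<n})" for n :: nat
  have Am: "A n \<in> sets lam" for n by (auto simp: A_def intro!: finite_imp_closed borel_closed)
  have conv: "(\<lambda>n. LINT x|lam. indicator (A n) x * f x) \<longlonglongrightarrow> (LINT x|lam. f x)"
  proof (rule integral_dominated_convergence[where w="\<lambda>x. \<bar>f x\<bar>"])
    show "AE x in lam. (\<lambda>n. indicator (A n) x * f x) \<longlonglongrightarrow> f x"
      using AE_lam
    proof eventually_elim
      case (elim x)
      then obtain N where "\<And>n. N \<le> n \<Longrightarrow> x \<in> A n"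
        unfolding A_def by (elim disjE exE) (auto dest: Suc_le_lessD)
      then show ?case
        by (intro tendsto_eventually eventually_sequentiallyI[of N]) auto
    qed
    show "integrable lam (\<lambda>x. \<bar>f x\<bar>)" using int by simp
    show "AE x in lam. norm (indicator (A n) x * f x) \<le> \<bar>f x\<bar>" for n
      by (auto simp: indicator_def)
    show "(\<lambda>x. indicator (A n) x * f x) \<in> borel_measurable lam" for n
      using Am by measurable
  qed simp
  have I: "integrable lam (\<lambda>x. c * indicator {y} x)" for c y :: real
    by (intro lam.integrable_const_bound[where B="\<bar>c\<bar>"]) (auto simp: indicator_def)
  have "(LINT x|lam. indicator (A n) x * f x)
      = f 1 * measure lam {1} + (\<Sum>l<n. f (- real l) * measure lam {- real l})" for n
  proof -
    have "indicator (A n) x * f x = f 1 * indicator {1} x + (\<Sum>l<n. f (- real l) * indicator {- real l} x)" for x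
    proof (cases "\<exists>l<n. x = - real l")
      case True
      then obtain l where l: "l < n" "x = - real l" by blast
      have "(\<Sum>l<n. f (- real l) * indicator {- real l} x) = f (- real l) * indicator {- real l} x"
        using l by (subst sum.remove[of _ l]) (auto intro!: sum.neutral simp: indicator_def)
      then show ?thesis using l by (auto simp: A_def indicator_def)
    next
      case False
      then have "(\<Sum>l<n. f (- real l) * indicator {- real l} x) = 0"
        by (intro sum.neutral) (auto simp: indicator_def)
      then show ?thesis using False by (auto simp: A_def indicator_def)
    qed
    then have "(LINT x|lam. indicator (A n) x * f x) = (LINT x|lam. f 1 * indicator {1} x + (\<Sum>l<n. f (- real l) * indicator {- real l} x))"
      by (simp only:)
    also have "\<dots> = (LINT x|lam. f 1 * indicator {1} x) + (\<Sum>l<n. LINT x|lam. f (- real l) * indicator {- real l} x)"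
      using I by (simp only: Bochner_Integration.integral_add Bochner_Integration.integral_sum Bochner_Integration.integrable_sum)
    finally show ?thesis by simp
  qed
  with conv have "(\<lambda>n. f 1 * measure lam {1} + (\<Sum>l<n. f (- real l) * measure lam {- real l})) \<longlonglongrightarrow> (LINT x|lam. f x)"
    by simp
  from tendsto_diff[OF this tendsto_const[of "f 1 * measure lam {1}"]]
  show "(\<lambda>l. f (- real l) * measure lam {- real l}) sums ((LINT x|lam. f x) - f 1 * measure lam {1})"
    by (simp add: sums_def)
qed

lemma measure_lam_sums:
  "(\<lambda>l. measure lam {- real l}) sums (measure lam UNIV - measure lam {1})"
  using integral_lam_sums[of "\<lambda>_. 1" 1] by simp

end

section \<open>Small-time asymptotics of the marginal laws\<close>

text \<open>Termwise comparison of exponential series, from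
  \<open>1 / (n + 1)! \<le> 1 / n!\<close>. It dominates the difference quotients in
  \<open>small_time_atom\<close>.\<close>

lemma norm_exp_minus_one_le:
  fixes w :: "'a::{real_normed_field, banach}"
  shows "norm (exp w - 1) \<le> norm w * exp (norm w)"
proof -
  have s: "(\<lambda>n. w ^ Suc n /\<^sub>R fact (Suc n)) sums (exp w - 1)"
    using sums_split_initial_segment[OF exp_converges[of w], of 1] by simp
  have b: "(\<lambda>n. norm w * (norm w ^ n /\<^sub>R fact n)) sums (norm w * exp (norm w))"
    by (intro sums_mult exp_converges)
  have "norm (w ^ Suc n /\<^sub>R fact (Suc n)) \<le> norm w * (norm w ^ n /\<^sub>R fact n)" for n
  proof -
    have "norm w * norm w ^ n * inverse (fact (Suc n)) \<le> norm w * norm w ^ n * inverse (fact n)"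
      by (intro mult_left_mono le_imp_inverse_le) (auto simp: fact_mono)
    then show ?thesis by (simp add: norm_mult norm_power divide_inverse mult_ac)
  qed
  from norm_suminf_le[OF this sums_summable[OF b]] s b show ?thesis
    by (simp add: sums_iff)
qed

lemma integral_iexp_int:
  "(CLINT u|restrict_space lborel {-pi..pi}. iexp (u * of_int k)) = (if k = 0 then 2 * pi else 0)"
proof (cases "k = 0")
  case True
  then show ?thesis
    by (simp add: integral_restrict_space measure_restrict_space scaleR_conv_of_real)
next
  case False
  let ?F = "\<lambda>u. iexp (u * of_int k) / (\<i> * of_int k)"
  have "(CLINT u|restrict_space lborel {-pi..pi}. iexp (u * of_int k))
     = (LINT u|lborel. indicator {-pi..pi} u *\<^sub>R iexp (u * of_int k))"
    by (simp add: integral_restrict_space set_lebesgue_integral_def)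
  also have "\<dots> = ?F pi - ?F (- pi)"
  proof (rule integral_FTC_Icc)
    show "(?F has_vector_derivative iexp (x * of_int k)) (at x within {-pi..pi})" for x
      using False
      by (auto intro!: derivative_eq_intros simp: has_vector_derivative_complex_iff Re_exp Im_exp Re_divide Im_divide power2_eq_square)
    show "continuous_on {-pi..pi} (\<lambda>x. iexp (x * of_int k))"
      by (intro continuous_intros)
  qed simp
  also have "iexp (pi * of_int k) = iexp (- pi * of_int k)"
    by (simp add: complex_eq_iff Re_exp Im_exp)
  then have "?F pi - ?F (- pi) = 0" by simp
  finally show ?thesis using False by simp
qed

text \<open>Fourier inversion on the integers: after Fubini the inner integral over \<open>u\<close>
  is 2 pi at \<open>x = n\<close> and 0 at every other integer. The measure is merely finite because
  the lemma is applied to \<open>lam\<close> as well as to the laws of the chain.\<close>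

lemma char_integral_lattice:
  assumes "finite_measure \<nu>" and sets_nu: "sets \<nu> = sets borel" and int: "AE x in \<nu>. x \<in> \<int>"
  shows "(CLINT u|restrict_space lborel {-pi..pi}. iexp (- u * of_int n) * char \<nu> u) = 2 * pi * measure \<nu> {of_int n}"
proof -
  interpret nu: finite_measure \<nu> by fact
  let ?L = "restrict_space lborel {-pi..pi}"
  interpret L: finite_measure ?L
    by standard (simp add: space_restrict_space emeasure_restrict_space)
  interpret P: pair_sigma_finite ?L \<nu> ..
  interpret PF: finite_measure "?L \<Otimes>\<^sub>M \<nu>" by (rule finite_measure_pair_measure) unfold_locales
  note sets_nu[measurable_cong]
  have id_L: "(\<lambda>u. u) \<in> borel_measurable ?L"
    by (rule measurable_restrict_space1) simp
  have id_nu: "(\<lambda>x. x) \<in> borel_measurable \<nu>"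
    by (simp add: measurable_ident_sets[OF sets_nu])
  note [measurable] = measurable_compose[OF measurable_fst id_L, of \<nu>]
    measurable_compose[OF measurable_snd id_nu, of ?L]
    measurable_compose[OF measurable_fst id_nu, of ?L]
    measurable_compose[OF measurable_snd id_L, of \<nu>]
  have "(CLINT u|?L. iexp (- u * of_int n) * char \<nu> u)
      = (CLINT u|?L. CLINT x|\<nu>. iexp (u * (x - of_int n)))"
    unfolding char_def by (subst integral_mult_right_zero[symmetric]) (simp add: exp_add[symmetric] algebra_simps)
  also have "\<dots> = (CLINT x|\<nu>. CLINT u|?L. iexp (u * (x - of_int n)))"
  proof (rule P.Fubini_integral[symmetric])
    show "integrable (?L \<Otimes>\<^sub>M \<nu>) (\<lambda>(u, x). iexp (u * (x - of_int n)))"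
      by (intro PF.integrable_const_bound[where B=1]) (auto simp: split_beta)
  qed
  also have "\<dots> = (CLINT x|\<nu>. complex_of_real (2 * pi * indicator {of_int n} x))"
  proof (rule integral_cong_AE)
    show "AE x in \<nu>. (CLINT u|?L. iexp (u * (x - of_int n))) = complex_of_real (2 * pi * indicator {of_int n} x)"
      using int
    proof eventually_elim
      case (elim x)
      then obtain m where m: "x = of_int m" by (auto elim: Ints_cases)
      show ?case
        using integral_iexp_int[of "m - n"] by (simp add: m)
    qed
    have "(\<lambda>(x, u). iexp (u * (x - of_int n))) \<in> borel_measurable (\<nu> \<Otimes>\<^sub>M ?L)"
      by (simp add: split_beta)
    then show "(\<lambda>x. CLINT u|?L. iexp (u * (x - of_int n))) \<in> borel_measurable \<nu>"
      by (rule L.borel_measurable_lebesgue_integral)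
    show "(\<lambda>x. complex_of_real (2 * pi * indicator {of_int n} x)) \<in> borel_measurable \<nu>"
      unfolding measurable_cong_sets[OF sets_nu refl] by measurable
  qed
  also have "\<dots> = 2 * pi * measure \<nu> {of_int n}"
    using sets_eq_imp_space_eq[OF sets_nu] by (subst integral_complex_of_real) simp
  finally show ?thesis .
qed


section \<open>Marginal laws of the chain: integer values and rates of the atoms\<close>

context usf_levy_chain
begin

abbreviation law :: "real \<Rightarrow> real measure" where
  "law t \<equiv> distr M borel (X t)"

lemma prob_space_law: "0 \<le> t \<Longrightarrow> prob_space (law t)"
  by (rule prob_space_distr) (rule meas)

text \<open>The characteristic exponent vanishes at \<open>2 * pi\<close> because \<open>lam\<close>
  sits on integers. Hence the cosine of \<open>2 * pi * X t\<close> has mean 1, and being at most 1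
  it equals 1 almost surely.\<close>

lemma AE_X_Ints: "0 \<le> t \<Longrightarrow> AE \<omega> in M. X t \<omega> \<in> \<int>"
proof -
  assume t: "0 \<le> t"
  note meas[OF t, measurable]
  have "(LINT x|lam. iexp (2 * pi * x) - 1) = (LINT x|lam. 0 :: complex)"
  proof (rule integral_cong_AE)
    show "AE x in lam. iexp (2 * pi * x) - 1 = 0"
      using AE_lam
    proof eventually_elim
      case (elim x)
      then obtain n :: int where "x = of_int n"
        by (metis of_int_1 of_int_minus of_int_of_nat_eq)
      then show ?case
        using cos_int_2pin[of n] sin_int_2pin[of n]
        by (simp add: complex_eq_iff Re_exp Im_exp)
    qed
  qed simp_all
  then have "char (law t) (2 * pi) = 1"
    using char_exponent[OF t, of "2 * pi"] by simp
  then have "(CLINT \<omega>|M. iexp (2 * pi * X t \<omega>)) = 1"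
    by (simp add: char_def integral_distr)
  then have "Re (CLINT \<omega>|M. iexp (2 * pi * X t \<omega>)) = 1" by simp
  then have "(LINT \<omega>|M. cos (2 * pi * X t \<omega>)) = 1"
    by (subst (asm) integral_Re[symmetric])
       (auto simp: Re_exp intro!: integrable_const_bound[where B=1])
  then have "(LINT \<omega>|M. 1 - cos (2 * pi * X t \<omega>)) = 0"
    by (subst Bochner_Integration.integral_diff)
       (auto simp: prob_space intro!: integrable_const_bound[where B=1])
  then have "AE \<omega> in M. 1 - cos (2 * pi * X t \<omega>) = 0"
    by (subst (asm) integral_nonneg_eq_0_iff_AE)
       (auto intro!: integrable_const_bound[where B=2] simp: abs_le_iff intro: order_trans[OF _ cos_ge_minus_one])
  then show ?thesis
  proof eventually_elim
    case (elim \<omega>)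
    then obtain n :: int where "2 * pi * X t \<omega> = of_int n * (2 * pi)"
      using cos_one_2pi_int[of "2 * pi * X t \<omega>"] by auto
    then have "X t \<omega> = of_int n" by simp
    then show ?case by simp
  qed
qed

lemma char_lam: "(LINT x|lam. iexp (u * x) - 1) = char lam u - measure lam UNIV"
  unfolding char_def
  by (subst Bochner_Integration.integral_diff)
     (auto intro!: lam.integrable_const_bound[where B=1] simp: scaleR_conv_of_real)

lemma norm_char_lam_le: "norm (char lam u) \<le> measure lam UNIV"
proof -
  have "norm (char lam u) \<le> (LINT x|lam. norm (iexp (u * x)))"
    unfolding char_def by (rule integral_norm_bound)
  then show ?thesis by simp
qed

text \<open>The derivative at \<open>t = 0\<close> of \<open>exp (t * psi u)\<close>, taken under
  the Fourier integral over a bounded interval; \<open>of_bool (n = 0)\<close> is the atom at time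
  0.\<close>

lemma small_time_atom:
  "(\<lambda>k. (measure (law (1 / Suc k)) {of_int n} - of_bool (n = 0)) * Suc k)
     \<longlonglongrightarrow> measure lam {of_int n} - measure lam UNIV * of_bool (n = 0)"
proof -
  let ?L = "restrict_space lborel {-pi..pi}"
  let ?g = "measure lam UNIV"
  define psi where "psi u = char lam u - ?g" for u
  interpret L: finite_measure ?L
    by standard (simp add: space_restrict_space emeasure_restrict_space)
  have [measurable]: "char lam \<in> borel_measurable borel"
    unfolding char_def by measurable
  have psi_m[measurable]: "psi \<in> borel_measurable borel" unfolding psi_def by measurable
  have psi_le: "norm (psi u) \<le> 2 * ?g" for u
    unfolding psi_def using norm_triangle_ineq4[of "char lam u" "of_real ?g"] norm_char_lam_le[of u] by simp
  have I0: "(CLINT u|?L. iexp (- u * of_int n)) = 2 * pi * of_bool (n = 0)"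
    using integral_iexp_int[of "- n"] by simp
  have int_iexp: "integrable ?L (\<lambda>u. iexp (- u * of_int n))"
    by (intro L.integrable_const_bound[where B=1] measurable_restrict_space1) auto
  have bdd: "integrable ?L (\<lambda>u. iexp (- u * of_int n) * F u)"
    if [measurable]: "F \<in> borel_measurable borel" and "\<And>u. norm (F u) \<le> B" for F :: "real \<Rightarrow> complex" and B
    using that(2) by (intro L.integrable_const_bound[where B=B] measurable_restrict_space1) (auto simp: norm_mult)
  have E: "(CLINT u|?L. iexp (- u * of_int n) * ((exp (psi u / Suc k) - 1) * Suc k))
      = 2 * pi * ((measure (law (1 / Suc k)) {of_int n} - of_bool (n = 0)) * Suc k)" for k
  proof -
    have t: "0 \<le> 1 / real (Suc k)" by simp
    interpret l: prob_space "law (1 / Suc k)" by (rule prob_space_law[OF t])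
    have ch: "char (law (1 / Suc k)) u = exp (psi u / Suc k)" for u
      using char_exponent[OF t, of u] unfolding char_lam psi_def by simp
    have chm: "char (law (1 / Suc k)) \<in> borel_measurable borel"
      unfolding char_def by measurable
    have chb: "norm (char (law (1 / Suc k)) u) \<le> 1" for u
    proof -
      have "norm (char (law (1 / Suc k)) u) \<le> (LINT x|law (1 / Suc k). norm (iexp (u * x)))"
        unfolding char_def by (rule integral_norm_bound)
      then show ?thesis using l.prob_space by simp
    qed
    have "AE x in law (1 / Suc k). x \<in> \<int>"
      using AE_X_Ints[OF t] meas[OF t] by (subst AE_distr_iff) auto
    then have I1: "(CLINT u|?L. iexp (- u * of_int n) * char (law (1 / Suc k)) u)
      = 2 * pi * measure (law (1 / Suc k)) {of_int n}"
      by (rule char_integral_lattice[OF l.finite_measure_axioms, rotated]) simp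
    have "(CLINT u|?L. iexp (- u * of_int n) * ((exp (psi u / Suc k) - 1) * Suc k))
       = (CLINT u|?L. (iexp (- u * of_int n) * char (law (1 / Suc k)) u - iexp (- u * of_int n)) * Suc k)"
      unfolding ch by (simp add: algebra_simps)
    also have "\<dots> = ((CLINT u|?L. iexp (- u * of_int n) * char (law (1 / Suc k)) u)
          - (CLINT u|?L. iexp (- u * of_int n))) * Suc k"
      using bdd[OF chm chb] int_iexp
      by (simp only: integral_mult_left_zero Bochner_Integration.integral_diff)
    finally show ?thesis unfolding I0 I1 by (simp add: algebra_simps)
  qed
  \<comment> \<open>The dominating constant comes from \<open>norm_exp_minus_one_le\<close> and
    \<open>norm (psi u) \<le> 2 * ?g\<close>; the factor \<open>Suc k\<close> cancels against the
    one in \<open>psi u / Suc k\<close>.\<close>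
  have "(\<lambda>k. CLINT u|?L. iexp (- u * of_int n) * ((exp (psi u / Suc k) - 1) * Suc k))
     \<longlonglongrightarrow> (CLINT u|?L. iexp (- u * of_int n) * psi u)"
  proof (rule integral_dominated_convergence[where w="\<lambda>_. 2 * ?g * exp (2 * ?g)"])
    show "AE u in ?L. (\<lambda>k. iexp (- u * of_int n) * ((exp (psi u / Suc k) - 1) * Suc k))
        \<longlonglongrightarrow> iexp (- u * of_int n) * psi u"
    proof (intro AE_I2 tendsto_mult tendsto_const)
      fix u
      have d: "((\<lambda>z. exp (psi u * z)) has_field_derivative psi u) (at 0)"
        by (auto intro!: derivative_eq_intros)
      have "filterlim (\<lambda>k. 1 / of_nat (Suc k) :: complex) (at 0) sequentially"
        using LIMSEQ_Suc[OF lim_1_over_n[where 'a=complex]]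
        by (intro filterlim_atI) (simp_all del: of_nat_Suc)
      from filterlim_compose[OF d[unfolded DERIV_def, simplified] this]
      show "(\<lambda>k. (exp (psi u / Suc k) - 1) * Suc k) \<longlonglongrightarrow> psi u"
        by simp
    qed
    show "AE u in ?L. norm (iexp (- u * of_int n) * ((exp (psi u / Suc k) - 1) * Suc k)) \<le> 2 * ?g * exp (2 * ?g)" for k
    proof (rule AE_I2)
      fix u
      have "norm (psi u / Suc k) \<le> norm (psi u)"
        unfolding norm_divide norm_of_nat by (simp add: divide_le_eq mult_le_cancel_left1 del: of_nat_Suc)
      then have le: "exp (norm (psi u / Suc k)) \<le> exp (2 * ?g)"
        using psi_le[of u] by simp
      have "norm (iexp (- u * of_int n) * ((exp (psi u / Suc k) - 1) * Suc k))
         = norm (exp (psi u / Suc k) - 1) * Suc k"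
        unfolding norm_mult norm_exp_i_times by (simp del: of_nat_Suc)
      also have "\<dots> \<le> norm (psi u / Suc k) * exp (norm (psi u / Suc k)) * Suc k"
        by (intro mult_right_mono norm_exp_minus_one_le) simp
      also have "\<dots> = norm (psi u) * exp (norm (psi u / Suc k))"
        by (simp add: norm_divide del: of_nat_Suc)
      also have "\<dots> \<le> 2 * ?g * exp (2 * ?g)"
        by (intro mult_mono le psi_le) auto
      finally show "norm (iexp (- u * of_int n) * ((exp (psi u / Suc k) - 1) * Suc k)) \<le> 2 * ?g * exp (2 * ?g)" .
    qed
    show "(\<lambda>u. iexp (- u * of_int n) * psi u) \<in> borel_measurable ?L"
      by (rule measurable_restrict_space1) measurable
    show "(\<lambda>u. iexp (- u * of_int n) * ((exp (psi u / Suc k) - 1) * Suc k)) \<in> borel_measurable ?L" for k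
      by (rule measurable_restrict_space1) measurable
  qed simp
  also have "(CLINT u|?L. iexp (- u * of_int n) * psi u)
     = (CLINT u|?L. iexp (- u * of_int n) * char lam u - iexp (- u * of_int n) * ?g)"
    unfolding psi_def by (simp only: right_diff_distrib)
  also have "\<dots> = (CLINT u|?L. iexp (- u * of_int n) * char lam u) - (CLINT u|?L. iexp (- u * of_int n)) * ?g"
    using bdd[OF _ norm_char_lam_le] int_iexp
    by (subst Bochner_Integration.integral_diff) auto
  also have "\<dots> = complex_of_real (2 * pi * (measure lam {of_int n} - ?g * of_bool (n = 0)))"
  proof -
    have "AE x in lam. x \<in> \<int>"
      using AE_lam by eventually_elim auto
    then show ?thesis
      unfolding I0 by (subst char_integral_lattice) (auto intro: lam.finite_measure_axioms simp: algebra_simps)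
  qed
  finally have "(\<lambda>k. complex_of_real (2 * pi * ((measure (law (1 / Suc k)) {of_int n} - of_bool (n = 0)) * Suc k)))
      \<longlonglongrightarrow> complex_of_real (2 * pi * (measure lam {of_int n} - ?g * of_bool (n = 0)))"
    unfolding E by simp
  then have "(\<lambda>k. 2 * pi * ((measure (law (1 / Suc k)) {of_int n} - of_bool (n = 0)) * Suc k))
      \<longlonglongrightarrow> 2 * pi * (measure lam {of_int n} - ?g * of_bool (n = 0))"
    unfolding tendsto_of_real_iff .
  from tendsto_mult_left[OF this, of "1 / (2 * pi)"] show ?thesis by simp
qed

end

section \<open>Random walks\<close>

text \<open>Success up to horizon \<open>K\<close> of the walk from \<open>x\<close> with increments
  \<open>s\<close>, organized by the first step so that conditioning on that step gives
  \<open>stay_prob\<close>. Running out of steps while nonnegative counts as success.\<close>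

primrec stays_until_above :: "real \<Rightarrow> nat \<Rightarrow> real \<Rightarrow> (nat \<Rightarrow> real) \<Rightarrow> bool" where
  "stays_until_above a 0 x s \<longleftrightarrow> 0 \<le> x"
| "stays_until_above a (Suc K) x s \<longleftrightarrow>
     a \<le> x \<or> 0 \<le> x \<and> stays_until_above a K (x + s 0) (\<lambda>i. s (Suc i))"

text \<open>Partial sums show what the recursion hides: the events decrease in \<open>K\<close>, and
  they have the shape of \<open>grid_stays\<close>. As \<open>0 < a\<close>, a start at or above
  \<open>a\<close> is nonnegative, so the clause \<open>k = 0\<close> holds there too.\<close>

lemma stays_until_above_iff:
  assumes "0 < a"
  shows "stays_until_above a K x s \<longleftrightarrow>
    (\<forall>k<Suc K. x + (\<Sum>i<k. s i) < 0 \<longrightarrow> (\<exists>j<k. a \<le> x + (\<Sum>i<j. s i)))"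
proof (induction K arbitrary: x s)
  case 0
  then show ?case by (auto simp: not_less)
next
  case (Suc K)
  have shift: "x + (\<Sum>i<Suc k. s i) = x + s 0 + (\<Sum>i<k. s (Suc i))" for k
    unfolding sum.lessThan_Suc_shift by simp
  show ?case
    unfolding stays_until_above.simps Suc.IH All_less_Suc2[of "Suc K"] Ex_less_Suc2 shift
    using assms by auto
qed

lemma measurable_stays_until_above:
  assumes "f \<in> borel_measurable M" "\<And>i. i < K \<Longrightarrow> (\<lambda>\<omega>. s \<omega> i) \<in> borel_measurable M"
  shows "Measurable.pred M (\<lambda>\<omega>. stays_until_above a K (f \<omega>) (s \<omega>))"
  using assms
proof (induction K arbitrary: f s)
  case 0
  note [measurable] = 0
  show ?case by simp
next
  case (Suc K)
  note [measurable] = Suc.prems(1) Suc.prems(2)[of 0, simplified]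
  have [measurable]: "Measurable.pred M (\<lambda>\<omega>. stays_until_above a K (f \<omega> + s \<omega> 0) (\<lambda>i. s \<omega> (Suc i)))"
    by (rule Suc.IH) (use Suc.prems in auto)
  show ?case by simp
qed

text \<open>First-step recursion for a walk with step law \<open>\<rho>\<close>; the
  infinite-horizon harmonic equation is then only a limit in \<open>K\<close>.\<close>

primrec stay_prob :: "real measure \<Rightarrow> real \<Rightarrow> nat \<Rightarrow> real \<Rightarrow> real" where
  "stay_prob \<rho> a 0 x = of_bool (0 \<le> x)"
| "stay_prob \<rho> a (Suc K) x =
     (if a \<le> x then 1 else if 0 \<le> x then LINT y|\<rho>. stay_prob \<rho> a K (x + y) else 0)"

lemma stays_until_above_cong:
  "(\<And>i. i < K \<Longrightarrow> s i = s' i) \<Longrightarrow> stays_until_above a K x s = stays_until_above a K x s'"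
proof (induction K arbitrary: x s s')
  case (Suc K)
  have "s 0 = s' 0" by (rule Suc.prems) simp
  moreover have "stays_until_above a K (x + s' 0) (\<lambda>i. s (Suc i)) = stays_until_above a K (x + s' 0) (\<lambda>i. s' (Suc i))"
    by (rule Suc.IH) (rule Suc.prems, simp)
  ultimately show ?case by (simp only: stays_until_above.simps)
qed (simp only: stays_until_above.simps)

lemma measurable_stay_prob:
  assumes "prob_space \<rho>" and [measurable_cong]: "sets \<rho> = sets borel"
  shows "stay_prob \<rho> a K \<in> borel_measurable borel"
proof (induction K)
  case (Suc K)
  interpret prob_space \<rho> by fact
  note [measurable] = Suc
  show ?case by simp
qed simp

text \<open>The Markov property at the first step: the first increment is independent of the block
  of later ones, and Fubini integrates it out. The offset \<open>m\<close> is free so that the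
  induction hypothesis applies to the shifted block.\<close>

lemma (in prob_space) prob_stays_until_above:
  fixes \<xi> :: "nat \<Rightarrow> 'a \<Rightarrow> real"
  assumes ind: "indep_vars (\<lambda>_. borel) \<xi> {..<n}" and law: "\<And>i. i < n \<Longrightarrow> distr M borel (\<xi> i) = \<rho>"
    and "m + K \<le> n"
  shows "prob {\<omega> \<in> space M. stays_until_above a K x (\<lambda>i. \<xi> (m + i) \<omega>)} = stay_prob \<rho> a K x"
  using \<open>m + K \<le> n\<close>
proof (induction K arbitrary: m x)
  case 0
  then show ?case by (simp add: prob_space)
next
  case (Suc K)
  have rv[measurable]: "i < n \<Longrightarrow> random_variable borel (\<xi> i)" for i
    using ind by (auto simp: indep_vars_def)
  have sp_m: "stay_prob \<rho> a K \<in> borel_measurable borel"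
    using law[of m] Suc.prems prob_space_distr[OF rv[of m]] by (intro measurable_stay_prob) auto
  define J where "J = {Suc m..<Suc m + K}"
  define T where "T \<omega> = restrict (\<lambda>i. \<xi> i \<omega>) J" for \<omega>
  let ?S = "PiM J (\<lambda>_. borel) :: (nat \<Rightarrow> real) measure"
  consider "a \<le> x" | "x < a" "x < 0" | "x < a" "0 \<le> x" by linarith
  then show ?case
  proof cases
    case 3
    have J: "{m} \<inter> J = {}" "{m} \<subseteq> {..<n}" "J \<subseteq> {..<n}"
      using Suc.prems by (auto simp: J_def)
    let ?R = "PiM {m} (\<lambda>_. borel) :: (nat \<Rightarrow> real) measure"
    \<comment> \<open>The first increment is kept as a function on the singleton \<open>{m}\<close>,
      to match the two-block form of \<open>indep_var_restrict\<close>.\<close>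
    define T0 where "T0 \<omega> = restrict (\<lambda>i. \<xi> i \<omega>) {m}" for \<omega>
    have iv: "indep_var ?R T0 ?S T"
      unfolding T_def T0_def by (rule indep_var_restrict[OF ind J])
    have T_m[measurable]: "T \<in> M \<rightarrow>\<^sub>M ?S" and T0_m[measurable]: "T0 \<in> M \<rightarrow>\<^sub>M ?R"
      using indep_var_rv2[OF iv] indep_var_rv1[OF iv] by auto
    have eq: "distr M (?R \<Otimes>\<^sub>M ?S) (\<lambda>\<omega>. (T0 \<omega>, T \<omega>)) = distr M ?R T0 \<Otimes>\<^sub>M distr M ?S T"
      using iv by (simp add: indep_var_distribution_eq)
    have rvm[measurable]: "random_variable borel (\<xi> m)" using Suc.prems by simp
    interpret T0: prob_space "distr M ?R T0" by (rule prob_space_distr) simp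
    interpret T: prob_space "distr M ?S T" by (rule prob_space_distr) simp
    interpret pair: pair_prob_space "distr M ?R T0" "distr M ?S T" ..
    define Q where "Q = {p \<in> space (?R \<Otimes>\<^sub>M ?S). stays_until_above a K (x + fst p m) (\<lambda>i. snd p (Suc m + i))}"
    have Q: "Q \<in> sets (?R \<Otimes>\<^sub>M ?S)"
      unfolding Q_def
    proof (rule predE, rule measurable_stays_until_above)
      have "(\<lambda>t. t m) \<in> ?R \<rightarrow>\<^sub>M borel"
        by (intro measurable_component_singleton) simp
      from measurable_compose[OF measurable_fst this]
      show "(\<lambda>p. x + fst p m) \<in> borel_measurable (?R \<Otimes>\<^sub>M ?S)"
        by (intro borel_measurable_add borel_measurable_const)
      fix i assume "i < K"
      then have "(\<lambda>t. t (Suc m + i)) \<in> ?S \<rightarrow>\<^sub>M borel"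
        by (intro measurable_component_singleton) (simp add: J_def)
      from measurable_compose[OF measurable_snd this]
      show "(\<lambda>p. snd p (Suc m + i)) \<in> borel_measurable (?R \<Otimes>\<^sub>M ?S)" .
    qed
    have sm0: "(\<lambda>t. stay_prob \<rho> a K (x + t m)) \<in> borel_measurable ?R"
      by (rule measurable_compose[OF _ sp_m]) (intro borel_measurable_add borel_measurable_const measurable_component_singleton, simp)
    have IH: "measure (distr M ?S T) (Pair t -` Q) = stay_prob \<rho> a K (x + t m)" if t: "t \<in> space ?R" for t
    proof -
      have "measure (distr M ?S T) (Pair t -` Q) = prob (T -` (Pair t -` Q) \<inter> space M)"
        using sets_Pair1[OF Q] by (intro measure_distr) auto
      also have "T -` (Pair t -` Q) \<inter> space M = {\<omega> \<in> space M. stays_until_above a K (x + t m) (\<lambda>i. \<xi> (Suc m + i) \<omega>)}"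
      proof -
        have "stays_until_above a K z (\<lambda>i. T \<omega> (Suc m + i)) \<longleftrightarrow> stays_until_above a K z (\<lambda>i. \<xi> (Suc m + i) \<omega>)" for \<omega> z
          by (rule stays_until_above_cong) (simp add: T_def J_def)
        moreover have "\<omega> \<in> space M \<Longrightarrow> T \<omega> \<in> space ?S" for \<omega>
          using measurable_space[OF T_m] by simp
        ultimately show ?thesis using t by (auto simp: Q_def space_pair_measure)
      qed
      also have "prob \<dots> = stay_prob \<rho> a K (x + t m)"
        using Suc.prems by (intro Suc.IH) simp
      finally show ?thesis .
    qed
    have "{\<omega> \<in> space M. stays_until_above a (Suc K) x (\<lambda>i. \<xi> (m + i) \<omega>)}
        = (\<lambda>\<omega>. (T0 \<omega>, T \<omega>)) -` Q \<inter> space M"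
    proof -
      have "stays_until_above a K (x + \<xi> m \<omega>) (\<lambda>i. \<xi> (m + Suc i) \<omega>)
          \<longleftrightarrow> stays_until_above a K (x + T0 \<omega> m) (\<lambda>i. T \<omega> (Suc m + i))" for \<omega>
        unfolding T0_def restrict_apply singleton_iff
        by (simp, rule stays_until_above_cong) (simp add: T_def J_def)
      moreover have "\<omega> \<in> space M \<Longrightarrow> (T0 \<omega>, T \<omega>) \<in> space (?R \<Otimes>\<^sub>M ?S)" for \<omega>
        using measurable_space[OF T_m] measurable_space[OF T0_m] by (simp add: space_pair_measure)
      ultimately show ?thesis
        using 3 by (intro set_eqI) (simp add: Q_def, blast)
    qed
    with measure_distr[OF measurable_Pair[OF T0_m T_m] Q]
    have "prob {\<omega> \<in> space M. stays_until_above a (Suc K) x (\<lambda>i. \<xi> (m + i) \<omega>)}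
        = measure (distr M ?R T0 \<Otimes>\<^sub>M distr M ?S T) Q"
      unfolding eq by (simp only:)
    also have "\<dots> = (LINT t|distr M ?R T0. stay_prob \<rho> a K (x + t m))"
    proof -
      have "emeasure (distr M ?R T0 \<Otimes>\<^sub>M distr M ?S T) Q
          = (\<integral>\<^sup>+t. emeasure (distr M ?S T) (Pair t -` Q) \<partial>distr M ?R T0)"
        using Q by (intro T.emeasure_pair_measure_alt) simp
      also have "\<dots> = (\<integral>\<^sup>+t. ennreal (stay_prob \<rho> a K (x + t m)) \<partial>distr M ?R T0)"
        by (intro nn_integral_cong) (simp add: T.emeasure_eq_measure IH)
      finally have "measure (distr M ?R T0 \<Otimes>\<^sub>M distr M ?S T) Q
          = enn2real (\<integral>\<^sup>+t. ennreal (stay_prob \<rho> a K (x + t m)) \<partial>distr M ?R T0)"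
        by (simp add: measure_def)
      also have "\<dots> = (LINT t|distr M ?R T0. stay_prob \<rho> a K (x + t m))"
      proof (rule integral_eq_nn_integral[symmetric])
        show "(\<lambda>t. stay_prob \<rho> a K (x + t m)) \<in> borel_measurable (distr M ?R T0)"
          using sm0 by simp
        \<comment> \<open>By \<open>IH\<close> the integrand is a measure, hence
          nonnegative.\<close>
        show "AE t in distr M ?R T0. 0 \<le> stay_prob \<rho> a K (x + t m)"
        proof (rule AE_I2)
          fix t assume "t \<in> space (distr M ?R T0)"
          then show "0 \<le> stay_prob \<rho> a K (x + t m)"
            using IH[of t, symmetric] by simp
        qed
      qed
      finally show ?thesis .
    qed
    also have "\<dots> = (LINT \<omega>|M. stay_prob \<rho> a K (x + \<xi> m \<omega>))"
      using sm0 by (subst integral_distr) (simp_all add: T0_def)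
    also have "\<dots> = (LINT y|distr M borel (\<xi> m). stay_prob \<rho> a K (x + y))"
      using measurable_compose[OF _ sp_m, of "\<lambda>y. x + y" borel] by (subst integral_distr) simp_all
    also have "distr M borel (\<xi> m) = \<rho>"
      using law[of m] Suc.prems by simp
    finally show ?thesis using 3 by simp
  next
    case 1
    then show ?thesis by (simp add: prob_space)
  next
    case 2
    then show ?thesis by simp
  qed
qed

section \<open>From skeleton walks to paths\<close>

text \<open>Started at \<open>x\<close>, the path visits \<open>[a, \<infinity>)\<close> before it is negative, or is never negative.
  A path that stays in the strip for ever thus counts as successful, in accordance with \<open>D\<^sub>1 \<le> x\<close>
  when \<open>T\<^sub>1 = \<infinity>\<close>.\<close>

definition path_stays :: "real \<Rightarrow> real \<Rightarrow> (real \<Rightarrow> real) \<Rightarrow> bool" where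
  "path_stays a x f \<longleftrightarrow> (\<forall>s\<ge>0. x + f s < 0 \<longrightarrow> (\<exists>t\<ge>0. t < s \<and> a \<le> x + f t))"

definition grid_stays :: "real \<Rightarrow> real \<Rightarrow> real \<Rightarrow> (real \<Rightarrow> real) \<Rightarrow> bool" where
  "grid_stays h a x f \<longleftrightarrow>
     (\<forall>n::nat. x + f (real n * h) < 0 \<longrightarrow> (\<exists>j<n. a \<le> x + f (real j * h)))"

text \<open>Two integers at distance less than 1 coincide.\<close>

lemma right_continuous_Ints_locally_const:
  fixes f :: "real \<Rightarrow> real"
  assumes lim: "(f \<longlongrightarrow> f t) (at_right t)" and int: "\<And>s. t \<le> s \<Longrightarrow> f s \<in> \<int>"
  obtains e where "e > t" "\<And>s. t \<le> s \<Longrightarrow> s < e \<Longrightarrow> f s = f t"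
proof -
  have "eventually (\<lambda>s. dist (f s) (f t) < 1) (at_right t)"
    using lim by (rule tendstoD) simp
  then obtain e where e: "e > t" "\<And>s. t < s \<Longrightarrow> s < e \<Longrightarrow> dist (f s) (f t) < 1"
    unfolding eventually_at_right_field by blast
  have "f s = f t" if "t \<le> s" "s < e" for s
  proof (cases "s = t")
    case False
    obtain m :: int where "f s = of_int m"
      using int[OF \<open>t \<le> s\<close>] by (rule Ints_cases)
    moreover obtain n :: int where "f t = of_int n"
      using int[OF order_refl] by (rule Ints_cases)
    ultimately show ?thesis using e(2)[of s] that False by (auto simp: dist_real_def)
  qed simp
  with e(1) show thesis by (rule that)
qed

lemma eventually_grid_point:
  fixes t e :: real
  assumes "0 \<le> t" "t < e"
  shows "\<forall>\<^sub>F k in sequentially. \<exists>n::nat. t \<le> real n * (1 / Suc k) \<and> real n * (1 / Suc k) < e"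
proof -
  have "\<forall>\<^sub>F k in sequentially. 1 / real (Suc k) < e - t"
    using LIMSEQ_Suc[OF lim_1_over_n[where 'a=real]] assms by (intro order_tendstoD(2)[of _ 0]) auto
  then show ?thesis
  proof eventually_elim
    case (elim k)
    define n where "n = nat \<lceil>t * Suc k\<rceil>"
    have n: "t * Suc k \<le> real n" "real n < t * Suc k + 1"
      using assms unfolding n_def by (auto simp: of_nat_nat) linarith+
    then have "t \<le> real n / Suc k" "real n / Suc k < t + 1 / Suc k"
      by (simp_all add: field_simps del: of_nat_Suc)
    then show ?case using elim by (intro exI[of _ n]) (auto simp del: of_nat_Suc)
  qed
qed

text \<open>A path that reaches \<open>a\<close> in time stays there during some
  \<open>[\<tau>, e)\<close>, and a fine grid has a point in this interval before any negative
  value. A path that fails at time \<open>s\<close> is constant and negative on some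
  \<open>[s, e)\<close>, which a fine grid also meets, with no earlier value at or above
  \<open>a\<close>. A path that is never negative succeeds on every grid.\<close>

lemma eventually_grid_stays_iff:
  fixes f :: "real \<Rightarrow> real"
  assumes rc: "\<And>t. 0 \<le> t \<Longrightarrow> (f \<longlongrightarrow> f t) (at_right t)"
    and int: "\<And>t. 0 \<le> t \<Longrightarrow> f t \<in> \<int>" and a: "0 \<le> a"
  shows "\<forall>\<^sub>F k in sequentially. grid_stays (1 / Suc k) a x f \<longleftrightarrow> path_stays a x f"
proof -
  have const: "\<exists>e>t. \<forall>s. t \<le> s \<longrightarrow> s < e \<longrightarrow> f s = f t" if "0 \<le> t" for t
    using right_continuous_Ints_locally_const[OF rc[OF that]] int that
    by (metis order_trans)
  show ?thesis
  proof (cases "path_stays a x f")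
    case True
    show ?thesis
    proof (cases "\<exists>t\<ge>0. a \<le> x + f t")
      case False
      with True have "\<And>s. 0 \<le> s \<Longrightarrow> 0 \<le> x + f s"
        unfolding path_stays_def by (meson not_less)
      then have "grid_stays (1 / Suc k) a x f" for k
        unfolding grid_stays_def by (metis mult_nonneg_nonneg not_less of_nat_0_le_iff zero_le_divide_1_iff)
      with True show ?thesis by simp
    next
      case ex: True
      define S where "S = {t. 0 \<le> t \<and> a \<le> x + f t}"
      define \<tau> where "\<tau> = Inf S"
      have S: "S \<noteq> {}" "bdd_below S" using ex by (auto simp: S_def)
      have \<tau>0: "0 \<le> \<tau>" unfolding \<tau>_def using S by (intro cInf_greatest) (auto simp: S_def)
      from const[OF \<tau>0] obtain e where e: "e > \<tau>" "\<And>s. \<tau> \<le> s \<Longrightarrow> s < e \<Longrightarrow> f s = f \<tau>" by blast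
      from e(1) obtain t where t: "t \<in> S" "t < e"
        unfolding \<tau>_def using cInf_lessD[OF S(1)] by blast
      have "\<tau> \<le> t" unfolding \<tau>_def using t S by (intro cInf_lower)
      from e(2)[OF this t(2)] t(1) have hit: "a \<le> x + f \<tau>" by (simp add: S_def)
      have before: "x + f s < a" if "0 \<le> s" "s < \<tau>" for s
      proof (rule ccontr)
        assume "\<not> x + f s < a"
        then have "s \<in> S" using that by (simp add: S_def)
        then have "\<tau> \<le> s" unfolding \<tau>_def using S(2) by (rule cInf_lower)
        with that show False by simp
      qed
      \<comment> \<open>A negative value before \<open>e\<close> would require an earlier visit to
        level \<open>a\<close>, hence a time at or after \<open>\<tau>\<close>; the path would then
        lie in \<open>[\<tau>, e)\<close>, where it keeps the hit value, which is at least
        \<open>a \<ge> 0\<close>.\<close>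
      have nonneg: "0 \<le> x + f s" if "0 \<le> s" "s < e" for s
      proof (rule ccontr)
        assume "\<not> 0 \<le> x + f s"
        then have neg: "x + f s < 0" by simp
        with True that obtain u where u: "0 \<le> u" "u < s" "a \<le> x + f u"
          unfolding path_stays_def by blast
        then have "\<tau> \<le> u" using before[of u] by force
        with u(2) have "\<tau> \<le> s" by simp
        from e(2)[OF this that(2)] have "f s = f \<tau>" .
        with neg hit a show False by simp
      qed
      have "\<forall>\<^sub>F k in sequentially. \<exists>n::nat. \<tau> \<le> real n * (1 / Suc k) \<and> real n * (1 / Suc k) < e"
        using \<tau>0 e(1) by (rule eventually_grid_point)
      then show ?thesis
      proof eventually_elim
        case (elim k)
        then obtain j :: nat where j: "\<tau> \<le> real j * (1 / Suc k)" "real j * (1 / Suc k) < e" by blast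
        have "grid_stays (1 / Suc k) a x f"
          unfolding grid_stays_def
        proof (intro allI impI)
          fix n :: nat assume "x + f (real n * (1 / Suc k)) < 0"
          then have "e \<le> real n * (1 / Suc k)"
            using nonneg[of "real n * (1 / Suc k)"] by force
          with j(2) have "real j * (1 / Suc k) < real n * (1 / Suc k)" by linarith
          then have "j < n"
            by (metis mult_less_cancel_right_disj not_less_iff_gr_or_eq of_nat_less_iff zero_less_divide_1_iff of_nat_0_less_iff zero_less_Suc)
          moreover have "a \<le> x + f (real j * (1 / Suc k))" using e(2)[OF j] hit by simp
          ultimately show "\<exists>j<n. a \<le> x + f (real j * (1 / Suc k))" by blast
        qed
        with True show ?case by simp
      qed
    qed
  next
    case False
    then obtain s where s: "0 \<le> s" "x + f s < 0" "\<And>t. 0 \<le> t \<Longrightarrow> t < s \<Longrightarrow> x + f t < a"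
      unfolding path_stays_def by (meson not_less)
    from const[OF s(1)] obtain e where e: "e > s" "\<And>t. s \<le> t \<Longrightarrow> t < e \<Longrightarrow> f t = f s" by blast
    have "\<forall>\<^sub>F k in sequentially. \<exists>n::nat. s \<le> real n * (1 / Suc k) \<and> real n * (1 / Suc k) < e"
      using s(1) e(1) by (rule eventually_grid_point)
    then show ?thesis
    proof eventually_elim
      case (elim k)
      then obtain n :: nat where n: "s \<le> real n * (1 / Suc k)" "real n * (1 / Suc k) < e" by blast
      have "x + f (real j * (1 / Suc k)) < a" if "j < n" for j
      proof (cases "real j * (1 / Suc k) < s")
        case True
        then show ?thesis by (intro s(3)) auto
      next
        case False
        have "real j * (1 / Suc k) \<le> real n * (1 / Suc k)"
          using that by (intro mult_right_mono) auto
        with False n e(2)[of "real j * (1 / Suc k)"] s(2) a show ?thesis by auto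
      qed
      moreover have "x + f (real n * (1 / Suc k)) < 0" using e(2)[OF n] s(2) by simp
      ultimately have "\<not> grid_stays (1 / Suc k) a x f"
        unfolding grid_stays_def by (meson not_less)
      with False show ?case by simp
    qed
  qed
qed

lemma stay_prob_bounds:
  assumes "prob_space \<rho>" "sets \<rho> = sets borel"
  shows "0 \<le> stay_prob \<rho> a K x \<and> stay_prob \<rho> a K x \<le> 1"
proof (induction K arbitrary: x)
  case (Suc K)
  interpret prob_space \<rho> by fact
  note [measurable_cong] = assms(2)
  note [measurable] = measurable_stay_prob[OF assms]
  have "integrable \<rho> (\<lambda>y. stay_prob \<rho> a K (x + y))"
    by (rule integrable_const_bound[where B=1]) (use Suc in auto)
  then show ?case using Suc by (auto intro: integral_nonneg integral_le_const)
qed simp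

text \<open>\<open>Q\<close> need not be measurable, but almost surely it coincides with the event
  that \<open>P k\<close> holds for all large \<open>k\<close>. It is thus measurable for the
  completion, and dominated convergence of indicators gives the limit.\<close>

lemma (in prob_space) completion_event_limit:
  assumes [measurable]: "\<And>k. Measurable.pred M (P k)"
    and lim: "AE \<omega> in M. \<forall>\<^sub>F k in sequentially. P k \<omega> \<longleftrightarrow> Q \<omega>"
  shows "(\<lambda>k. prob {\<omega> \<in> space M. P k \<omega>}) \<longlonglongrightarrow> measure (completion M) {\<omega> \<in> space M. Q \<omega>}"
proof -
  define C where "C = {\<omega> \<in> space M. \<forall>\<^sub>F k in sequentially. P k \<omega>}"
  have C[measurable]: "C \<in> sets M"
    unfolding C_def eventually_sequentially by measurable
  have iff: "AE \<omega> in M. \<omega> \<in> C \<longleftrightarrow> \<omega> \<in> {\<omega> \<in> space M. Q \<omega>}"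
    using lim
  proof (rule AE_mp, intro AE_I2 impI)
    fix \<omega> assume \<omega>: "\<omega> \<in> space M" and ev: "\<forall>\<^sub>F k in sequentially. P k \<omega> \<longleftrightarrow> Q \<omega>"
    have "(\<forall>\<^sub>F k in sequentially. P k \<omega>) \<longleftrightarrow> (\<forall>\<^sub>F k::nat in sequentially. Q \<omega>)"
      using ev by (rule eventually_cong) 
    with \<omega> show "\<omega> \<in> C \<longleftrightarrow> \<omega> \<in> {\<omega> \<in> space M. Q \<omega>}" by (simp add: C_def)
  qed
  then have iffc: "AE \<omega> in completion M. \<omega> \<in> C \<longleftrightarrow> \<omega> \<in> {\<omega> \<in> space M. Q \<omega>}"
    by (rule AE_completion)
  have Q: "{\<omega> \<in> space M. Q \<omega>} \<in> sets (completion M)"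
    using iffc by (rule completion.in_sets_AE) auto
  have "measure (completion M) {\<omega> \<in> space M. Q \<omega>} = measure (completion M) C"
    by (rule measure_eq_AE[symmetric, OF iffc]) (use Q in auto)
  also have "\<dots> = (LINT \<omega>|M. indicator C \<omega>)" by simp
  finally have eq: "measure (completion M) {\<omega> \<in> space M. Q \<omega>} = (LINT \<omega>|M. indicator C \<omega>)" .
  have "(\<lambda>k. LINT \<omega>|M. indicator {\<omega> \<in> space M. P k \<omega>} \<omega>) \<longlonglongrightarrow> (LINT \<omega>|M. (indicator C \<omega> :: real))"
  proof (rule integral_dominated_convergence[where w="\<lambda>_. 1"])
    show "AE \<omega> in M. (\<lambda>k. indicator {\<omega> \<in> space M. P k \<omega>} \<omega>) \<longlonglongrightarrow> (indicator C \<omega> :: real)"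
      using lim iff
    proof (rule AE_mp[OF _ AE_mp], intro AE_I2 impI)
      fix \<omega> assume \<omega>: "\<omega> \<in> space M" and ev: "\<forall>\<^sub>F k in sequentially. P k \<omega> \<longleftrightarrow> Q \<omega>"
        and "\<omega> \<in> C \<longleftrightarrow> \<omega> \<in> {\<omega> \<in> space M. Q \<omega>}"
      with \<omega> show "(\<lambda>k. indicator {\<omega> \<in> space M. P k \<omega>} \<omega>) \<longlonglongrightarrow> (indicator C \<omega> :: real)"
        by (intro tendsto_eventually eventually_mono[OF ev]) (auto simp: indicator_def)
    qed
  qed auto
  then show "(\<lambda>k. prob {\<omega> \<in> space M. P k \<omega>}) \<longlonglongrightarrow> measure (completion M) {\<omega> \<in> space M. Q \<omega>}"
    by (simp add: eq)
qed

section \<open>Skeleton probabilities of the chain and their limits\<close>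

context usf_levy_chain
begin

text \<open>\<open>AE_X_Ints\<close> can be combined over countably many times only;
  right-continuity and closedness of the integers extend it from the rational times to all.\<close>

lemma AE_good_path:
  "AE \<omega> in M. X 0 \<omega> = 0 \<and> (\<forall>t\<ge>0. ((\<lambda>t. X t \<omega>) \<longlongrightarrow> X t \<omega>) (at_right t) \<and> X t \<omega> \<in> \<int>)"
proof -
  have "AE \<omega> in M. \<forall>r\<in>{r\<in>\<rat>. 0 \<le> r}. X r \<omega> \<in> \<int>"
    using AE_X_Ints countable_rat by (subst AE_ball_countable) (auto intro: countable_subset)
  with cadlag_paths start show ?thesis
  proof eventually_elim
    case (elim \<omega>)
    have rc: "((\<lambda>t. X t \<omega>) \<longlongrightarrow> X t \<omega>) (at_right t)" if "0 \<le> t" for t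
      using elim(1) that by (auto simp: cadlag_def)
    have "X t \<omega> \<in> \<int>" if t: "0 \<le> t" for t
    proof (rule ccontr)
      assume "X t \<omega> \<notin> \<int>"
      then have "eventually (\<lambda>s. X s \<omega> \<in> - \<int>) (at_right t)"
        using rc[OF t] by (intro topological_tendstoD[where S="- \<int>"]) auto
      then obtain b where b: "b > t" "\<And>s. t < s \<Longrightarrow> s < b \<Longrightarrow> X s \<omega> \<notin> \<int>"
        unfolding eventually_at_right_field by auto
      obtain r where "r \<in> \<rat>" "t < r" "r < b" using Rats_dense_in_real[OF b(1)] by blast
      with b elim t show False by auto
    qed
    with rc elim show ?case by auto
  qed
qed

definition grid_prob :: "real \<Rightarrow> real \<Rightarrow> real \<Rightarrow> real" where
  "grid_prob h a x = prob {\<omega> \<in> space M. \<forall>K. stays_until_above a K x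
     (\<lambda>i. X (real (Suc i) * h) \<omega> - X (real i * h) \<omega>)}"

definition exit_prob :: "real \<Rightarrow> real \<Rightarrow> real" where
  "exit_prob a x = measure (completion M) {\<omega> \<in> space M. path_stays a x (\<lambda>t. X t \<omega>)}"

lemma measurable_grid:
  assumes "0 \<le> h"
  shows "Measurable.pred M (\<lambda>\<omega>. stays_until_above a K x (\<lambda>i. X (real (Suc i) * h) \<omega> - X (real i * h) \<omega>))"
  by (intro measurable_stays_until_above borel_measurable_diff meas borel_measurable_const) (use assms in auto)

lemma grid_prob_tendsto_exit_prob:
  assumes a: "0 < a"
  shows "(\<lambda>k. grid_prob (1 / Suc k) a x) \<longlonglongrightarrow> exit_prob a x"
proof -
  define P where "P k \<omega> \<longleftrightarrow> (\<forall>K. stays_until_above a K x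
    (\<lambda>i. X (real (Suc i) * (1 / Suc k)) \<omega> - X (real i * (1 / Suc k)) \<omega>))" for k \<omega>
  have meas_P: "Measurable.pred M (P k)" for k
    unfolding P_def by (intro pred_intros_countable measurable_grid) simp
  have "AE \<omega> in M. \<forall>\<^sub>F k in sequentially. P k \<omega> \<longleftrightarrow> path_stays a x (\<lambda>t. X t \<omega>)"
    using AE_good_path
  proof eventually_elim
    case (elim \<omega>)
    have "P k \<omega> \<longleftrightarrow> grid_stays (1 / Suc k) a x (\<lambda>t. X t \<omega>)" for k
    proof -
      have sum: "(\<Sum>i<n. X (real (Suc i) * (1 / Suc k)) \<omega> - X (real i * (1 / Suc k)) \<omega>) = X (real n * (1 / Suc k)) \<omega>" for n
        using sum_lessThan_telescope[of "\<lambda>i. X (real i * (1 / Suc k)) \<omega>" n] elim by simp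
      show ?thesis
        unfolding P_def stays_until_above_iff[OF a] grid_stays_def sum by (meson lessI)
    qed
    then show ?case
      using eventually_grid_stays_iff[of "\<lambda>t. X t \<omega>" a x] elim a by simp
  qed
  from completion_event_limit[OF meas_P this]
  show "(\<lambda>k. grid_prob (1 / Suc k) a x) \<longlonglongrightarrow> exit_prob a x"
    unfolding grid_prob_def exit_prob_def P_def by simp
qed

lemma stay_prob_tendsto_grid_prob:
  assumes h: "0 \<le> h" and a: "0 < a"
  shows "(\<lambda>K. stay_prob (law h) a K x) \<longlonglongrightarrow> grid_prob h a x"
proof -
  define \<xi> where "\<xi> i \<omega> = X (real (Suc i) * h) \<omega> - X (real i * h) \<omega>" for i \<omega>
  let ?E = "\<lambda>K. {\<omega> \<in> space M. stays_until_above a K x (\<lambda>i. \<xi> i \<omega>)}"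
  have "prob (?E K) = stay_prob (law h) a K x" for K
  proof -
    have "mono (\<lambda>i. real i * h)" using h by (intro monoI mult_right_mono) auto
    then have "indep_vars (\<lambda>_. borel) \<xi> {..<K}"
      using indep_increments[of "\<lambda>i. real i * h" K] unfolding \<xi>_def by simp
    moreover have "distr M borel (\<xi> i) = law h" for i
      using stationary_increments[of "real i * h" h] h unfolding \<xi>_def by (simp add: algebra_simps)
    ultimately show ?thesis
      using prob_stays_until_above[of \<xi> K "law h" 0 K a x] by simp
  qed
  moreover have "(\<lambda>K. prob (?E K)) \<longlonglongrightarrow> prob (\<Inter>K. ?E K)"
  proof (rule finite_Lim_measure_decseq)
    show "range ?E \<subseteq> events"
      using measurable_grid[OF h] unfolding \<xi>_def by auto
    show "decseq ?E"
      unfolding decseq_def stays_until_above_iff[OF a] by auto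
  qed
  moreover have "(\<Inter>K. ?E K) = {\<omega> \<in> space M. \<forall>K. stays_until_above a K x (\<lambda>i. \<xi> i \<omega>)}" by auto
  ultimately show ?thesis unfolding grid_prob_def \<xi>_def by simp
qed

lemma measurable_grid_prob:
  assumes "0 \<le> h" "0 < a"
  shows "grid_prob h a \<in> borel_measurable borel"
  using stay_prob_tendsto_grid_prob[OF assms] 
  by (rule borel_measurable_LIMSEQ_real[OF _ measurable_stay_prob]) (auto intro: prob_space_law assms)

lemma grid_prob_ge: "0 \<le> h \<Longrightarrow> 0 < a \<Longrightarrow> a \<le> x \<Longrightarrow> grid_prob h a x = 1"
proof (rule LIMSEQ_unique[OF stay_prob_tendsto_grid_prob])
  assume "0 < a" "a \<le> x"
  then have "stay_prob (law h) a K x = 1" for K by (cases K) auto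
  then show "(\<lambda>K. stay_prob (law h) a K x) \<longlonglongrightarrow> 1" by simp
qed

lemma grid_prob_neg: "0 \<le> h \<Longrightarrow> 0 < a \<Longrightarrow> x < 0 \<Longrightarrow> grid_prob h a x = 0"
proof (rule LIMSEQ_unique[OF stay_prob_tendsto_grid_prob])
  assume "0 < a" "x < 0"
  then have "stay_prob (law h) a K x = 0" for K by (cases K) auto
  then show "(\<lambda>K. stay_prob (law h) a K x) \<longlonglongrightarrow> 0" by simp
qed

text \<open>The recursion of \<open>stay_prob\<close> survives the limit in \<open>K\<close> by
  dominated convergence, all values lying in [0, 1].\<close>

lemma grid_prob_harmonic:
  assumes h: "0 \<le> h" and a: "0 < a" and x: "0 \<le> x" "x < a"
  shows "grid_prob h a x = (LINT y|law h. grid_prob h a (x + y))"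
proof (rule LIMSEQ_unique[OF LIMSEQ_Suc[OF stay_prob_tendsto_grid_prob[OF h a]]])
  interpret l: prob_space "law h" by (rule prob_space_law[OF h])
  note [measurable] = measurable_stay_prob[OF prob_space_law[OF h]] measurable_grid_prob[OF h a]
  have "(\<lambda>K. LINT y|law h. stay_prob (law h) a K (x + y)) \<longlonglongrightarrow> (LINT y|law h. grid_prob h a (x + y))"
  proof (rule integral_dominated_convergence[where w="\<lambda>_. 1"])
    show "AE y in law h. norm (stay_prob (law h) a K (x + y)) \<le> 1" for K
      using stay_prob_bounds[OF prob_space_law[OF h]] by auto
  qed (auto intro: stay_prob_tendsto_grid_prob[OF h a])
  then show "(\<lambda>K. stay_prob (law h) a (Suc K) x) \<longlonglongrightarrow> (LINT y|law h. grid_prob h a (x + y))"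
    using x by simp
qed

end

section \<open>Exit probabilities and the scale function\<close>

text \<open>The sequence \<open>v\<close> of the overview when \<open>a\<close> is the mass at 1,
  \<open>g\<close> the total mass and \<open>m l\<close> the mass at \<open>-l\<close>. The sum
  starts at \<open>l = 0\<close> so that it is a full Cauchy product.\<close>

fun renewal_seq :: "real \<Rightarrow> real \<Rightarrow> (nat \<Rightarrow> real) \<Rightarrow> nat \<Rightarrow> real" where
  "renewal_seq a g m 0 = 1"
| "renewal_seq a g m (Suc n) = (g * renewal_seq a g m n - (\<Sum>l\<le>n. m l * renewal_seq a g m (n - l))) / a"

text \<open>Equation \<open>i\<close> determines \<open>u (i + 1)\<close> from earlier values, so
  only \<open>u 0\<close> remains free.\<close>

lemma renewal_seq_unique:
  assumes "a \<noteq> 0"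
    and rec: "\<And>i. i < A \<Longrightarrow> g * u i = a * u (Suc i) + (\<Sum>l\<le>i. m l * u (i - l))"
    and "i \<le> A"
  shows "u i = u 0 * renewal_seq a g m i"
  using \<open>i \<le> A\<close>
proof (induction i rule: less_induct)
  case (less i)
  show ?case
  proof (cases i)
    case (Suc n)
    have "u (Suc n) = (g * u n - (\<Sum>l\<le>n. m l * u (n - l))) / a"
      using rec[of n] less.prems Suc \<open>a \<noteq> 0\<close> by (simp add: field_simps)
    also have "(\<Sum>l\<le>n. m l * u (n - l)) = (\<Sum>l\<le>n. u 0 * (m l * renewal_seq a g m (n - l)))"
    proof (rule sum.cong)
      fix l assume "l \<in> {..n}"
      have "u (n - l) = u 0 * renewal_seq a g m (n - l)"
        by (rule less.IH) (use less.prems Suc in auto)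
      then show "m l * u (n - l) = u 0 * (m l * renewal_seq a g m (n - l))"
        by (simp only: mult.left_commute)
    qed simp
    also have "u n = u 0 * renewal_seq a g m n"
      by (rule less.IH) (use less.prems Suc in auto)
    finally show ?thesis
      by (simp add: Suc sum_distrib_left[symmetric] right_diff_distrib)
  qed simp
qed

text \<open>Shifting by \<open>x\<close> turns level 1 into \<open>x + 1\<close> and the bound
  \<open>- x\<close> into 0. The infima need not be attained: \<open>s\<close> exceeds
  \<open>T1\<close> exactly when some \<open>t < s\<close> has already reached 1, so the closed
  range \<open>s \<le> T1\<close> matches the strict \<open>t < s\<close> of
  \<open>path_stays\<close>.\<close>

lemma D1_le_iff: "D1 X \<omega> \<le> ereal x \<longleftrightarrow> path_stays (x + 1) x (\<lambda>t. X t \<omega>)"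
proof -
  have "D1 X \<omega> \<le> ereal x \<longleftrightarrow> (\<forall>s. 0 \<le> s \<and> ereal s \<le> T1 X \<omega> \<longrightarrow> - x \<le> X s \<omega>)"
    unfolding D1_def by (subst ereal_uminus_le_reorder) (auto simp: le_Inf_iff)
  also have "\<dots> \<longleftrightarrow> path_stays (x + 1) x (\<lambda>t. X t \<omega>)"
  proof
    assume L: "\<forall>s. 0 \<le> s \<and> ereal s \<le> T1 X \<omega> \<longrightarrow> - x \<le> X s \<omega>"
    show "path_stays (x + 1) x (\<lambda>t. X t \<omega>)"
      unfolding path_stays_def
    proof (intro allI impI)
      fix s :: real assume s: "0 \<le> s" "x + X s \<omega> < 0"
      then have "\<not> ereal s \<le> T1 X \<omega>" using L[rule_format, of s] by auto
      then show "\<exists>t\<ge>0. t < s \<and> x + 1 \<le> x + X t \<omega>"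
        unfolding T1_def le_Inf_iff by (auto simp: not_le)
    qed
  next
    assume R: "path_stays (x + 1) x (\<lambda>t. X t \<omega>)"
    show "\<forall>s. 0 \<le> s \<and> ereal s \<le> T1 X \<omega> \<longrightarrow> - x \<le> X s \<omega>"
    proof (intro allI impI, rule ccontr)
      fix s :: real assume s: "0 \<le> s \<and> ereal s \<le> T1 X \<omega>" "\<not> - x \<le> X s \<omega>"
      with R obtain t where t: "0 \<le> t" "t < s" "1 \<le> X t \<omega>"
        unfolding path_stays_def by force
      have "T1 X \<omega> \<le> ereal t" unfolding T1_def using t by (intro Inf_lower) auto
      with s t show False by (metis dual_order.trans ereal_less_eq(3) not_le)
    qed
  qed
  finally show ?thesis .
qed

section \<open>The linear system for the exit probabilities\<close>

context usf_levy_chain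
begin

lemma prob_D1_le_eq: "prob_D1_le M X x = exit_prob (x + 1) x"
  unfolding prob_D1_le_def exit_prob_def D1_le_iff ..

abbreviation neg_mass :: "nat \<Rightarrow> real" where
  "neg_mass l \<equiv> measure lam {- real l}"

lemma AE_law_Ints: "0 \<le> t \<Longrightarrow> AE y in law t. y \<in> \<int>"
  using AE_X_Ints meas by (subst AE_distr_iff) auto

text \<open>The mass of \<open>{2..}\<close> is at most 1 minus the atoms at 1, 0, ..., -L. Divided
  by the mesh, this bound tends to the mass of \<open>lam\<close> below \<open>-L\<close>, which is
  small for large \<open>L\<close>.\<close>

lemma small_time_tail_ge2:
  "(\<lambda>k. measure (law (1 / Suc k)) {2..} * Suc k) \<longlonglongrightarrow> 0"
proof (rule LIMSEQ_I)
  fix \<epsilon> :: real assume \<epsilon>: "0 < \<epsilon>"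
  let ?g = "measure lam UNIV" and ?p = "measure lam {1}"
  have "(\<lambda>n. \<Sum>l<Suc n. neg_mass l) \<longlonglongrightarrow> ?g - ?p"
    using measure_lam_sums unfolding sums_def by (rule LIMSEQ_Suc)
  from LIMSEQ_D[OF this \<epsilon>] obtain L where "\<bar>(\<Sum>l<Suc L. neg_mass l) - (?g - ?p)\<bar> < \<epsilon>"
    by auto
  then have L: "?g - ?p - (\<Sum>l<Suc L. neg_mass l) < \<epsilon>" by linarith
  \<comment> \<open>The total probability 1 is hidden in the \<open>of_bool\<close> term at
    \<open>l = 0\<close>, and the same term supplies \<open>?g\<close> in the limit.\<close>
  define b where "b k = - (\<Sum>l<Suc L. (measure (law (1 / Suc k)) {of_int (- int l)} - of_bool (- int l = 0)) * Suc k)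
     - (measure (law (1 / Suc k)) {of_int 1} - of_bool ((1::int) = 0)) * Suc k" for k
  have "b \<longlonglongrightarrow> - (\<Sum>l<Suc L. measure lam {of_int (- int l)} - ?g * of_bool (- int l = 0))
     - (measure lam {of_int 1} - ?g * of_bool ((1::int) = 0))"
    unfolding b_def by (intro tendsto_diff tendsto_minus tendsto_sum small_time_atom)
  also have "- (\<Sum>l<Suc L. measure lam {of_int (- int l)} - ?g * of_bool (- int l = 0))
     - (measure lam {of_int 1} - ?g * of_bool ((1::int) = 0)) = ?g - ?p - (\<Sum>l<Suc L. neg_mass l)"
    by (simp add: sum_subtractf sum.lessThan_Suc_shift)
  finally have "\<forall>\<^sub>F k in sequentially. b k < \<epsilon>" using L by (rule order_tendstoD)
  then obtain N where N: "\<And>k. N \<le> k \<Longrightarrow> b k < \<epsilon>" unfolding eventually_sequentially by blast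
  have "measure (law (1 / Suc k)) {2..} * Suc k \<le> b k" for k
  proof -
    interpret l: prob_space "law (1 / Suc k)" by (rule prob_space_law) simp
    let ?m = "measure (law (1 / Suc k))"
    let ?A = "(\<lambda>l. - real l) ` {..<Suc L}"
    have "?m {2..} + ?m {1} + ?m ?A = ?m ({2..} \<union> {1} \<union> ?A)"
      by (subst l.finite_measure_Union, simp, simp add: finite_imp_closed borel_closed, force,
          subst l.finite_measure_Union) auto
    also have "\<dots> \<le> 1" by (rule l.prob_le_1)
    also have "?m ?A = (\<Sum>x\<in>?A. ?m {x})"
      by (rule l.finite_measure_eq_sum_singleton) auto
    also have "\<dots> = (\<Sum>l<Suc L. ?m {- real l})"
      by (subst sum.reindex) (auto simp: inj_on_def)
    finally have "?m {2..} \<le> 1 - ?m {1} - (\<Sum>l<Suc L. ?m {- real l})" by simp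
    then have "?m {2..} * Suc k \<le> (1 - ?m {1} - (\<Sum>l<Suc L. ?m {- real l})) * Suc k"
      by (rule mult_right_mono) simp
    also have "\<dots> = b k"
      unfolding b_def sum_distrib_right[symmetric] sum_subtractf
      by (simp add: sum.lessThan_Suc_shift algebra_simps)
    finally show ?thesis .
  qed
  with N show "\<exists>N. \<forall>k\<ge>N. norm (measure (law (1 / Suc k)) {2..} * Suc k - 0) < \<epsilon>"
    by (intro exI[of _ N]) (auto intro: le_less_trans simp del: of_nat_Suc)
qed

lemma small_time_tail:
  assumes "1 \<le> n"
  shows "(\<lambda>k. measure (law (1 / Suc k)) {real n..} * Suc k) \<longlonglongrightarrow> of_bool (n = 1) * measure lam {1}"
proof (cases "n = 1")
  case True
  have "measure (law (1 / Suc k)) {1..} = measure (law (1 / Suc k)) {1} + measure (law (1 / Suc k)) {2..}" for k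
  proof -
    have t: "0 \<le> 1 / real (Suc k)" by simp
    interpret l: prob_space "law (1 / Suc k)" by (rule prob_space_law[OF t])
    have "measure (law (1 / Suc k)) {1..} = measure (law (1 / Suc k)) ({1} \<union> {2..})"
    proof (rule measure_eq_AE)
      show "AE y in law (1 / Suc k). y \<in> {1..} \<longleftrightarrow> y \<in> {1} \<union> {2..}"
        using AE_law_Ints[OF t] by eventually_elim (auto elim!: Ints_cases)
    qed auto
    also have "\<dots> = measure (law (1 / Suc k)) {1} + measure (law (1 / Suc k)) {2..}"
      by (rule l.finite_measure_Union) auto
    finally show ?thesis .
  qed
  with tendsto_add[OF small_time_atom[of 1] small_time_tail_ge2] True show ?thesis
    by (simp add: distrib_right)
next
  case False
  with assms have n: "2 \<le> n" by simp
  have "(\<lambda>k. measure (law (1 / Suc k)) {real n..} * Suc k) \<longlonglongrightarrow> 0"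
  proof (rule tendsto_sandwich[OF _ _ tendsto_const small_time_tail_ge2])
    show "\<forall>\<^sub>F k in sequentially. measure (law (1 / Suc k)) {real n..} * Suc k \<le> measure (law (1 / Suc k)) {2..} * Suc k"
    proof (intro always_eventually allI mult_right_mono)
      fix k
      interpret l: prob_space "law (1 / Suc k)" by (rule prob_space_law) simp
      show "measure (law (1 / Suc k)) {real n..} \<le> measure (law (1 / Suc k)) {2..}"
        using n by (intro l.finite_measure_mono) auto
    qed simp
  qed simp
  with False show ?thesis by simp
qed

text \<open>Landing points of one step are negative (value 0), below \<open>A\<close> (the finite
  sum) or at least \<open>A\<close> (value 1). Subtracting the value at \<open>i\<close> and
  dividing by the mesh leaves exactly the rates treated in \<open>small_time_atom\<close> and
  \<open>small_time_tail\<close>.\<close>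

lemma grid_prob_equation:
  assumes "i < A"
  shows "(\<Sum>j<A. grid_prob (1 / Suc k) (real A) (real j) *
      ((measure (law (1 / Suc k)) {of_int (int j - int i)} - of_bool (int j - int i = 0)) * Suc k))
    + measure (law (1 / Suc k)) {real (A - i)..} * Suc k = 0"
proof -
  let ?h = "1 / real (Suc k)" and ?m = "measure (law (1 / Suc k))"
  let ?g = "\<lambda>x. grid_prob (1 / Suc k) (real A) x"
  have t: "0 \<le> ?h" by simp
  have A: "0 < real A" using assms by simp
  interpret l: prob_space "law ?h" by (rule prob_space_law[OF t])
  have I: "integrable (law ?h) (\<lambda>y. c * indicator S y)" if "S \<in> sets borel" for c :: real and S
    using that by (intro l.integrable_const_bound[where B="\<bar>c\<bar>"]) (auto simp: indicator_def)
  have "?g (real i) = (LINT y|law ?h. ?g (real i + y))"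
    using grid_prob_harmonic[OF t A, of "real i"] assms by simp
  also have "\<dots> = (LINT y|law ?h. (\<Sum>j<A. ?g (real j) * indicator {of_int (int j - int i)} y) + 1 * indicator {real (A - i)..} y)"
  proof (rule integral_cong_AE)
    show "AE y in law ?h. ?g (real i + y) = (\<Sum>j<A. ?g (real j) * indicator {of_int (int j - int i)} y) + 1 * indicator {real (A - i)..} y"
      using AE_law_Ints[OF t]
    proof eventually_elim
      case (elim y)
      then obtain n where n: "y = of_int n" by (rule Ints_cases)
      consider "int i + n < 0" | "0 \<le> int i + n" "int i + n < int A" | "int A \<le> int i + n" by linarith
      then show ?case
      proof cases
        case 1
        then have "?g (real i + y) = 0" using n by (intro grid_prob_neg[OF t A]) linarith
        moreover have "(\<Sum>j<A. ?g (real j) * indicator {of_int (int j - int i)} y) = 0"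
          using 1 n by (intro sum.neutral) (auto simp: indicator_def)
        ultimately show ?thesis using 1 n assms by (auto simp: indicator_def)
      next
        case 2
        define j0 where "j0 = nat (int i + n)"
        have j0: "j0 < A" "n = int j0 - int i" using 2 by (auto simp: j0_def)
        have "(\<Sum>j<A. ?g (real j) * indicator {of_int (int j - int i)} y) = ?g (real j0)"
          using j0 n by (subst sum.remove[of _ j0]) (auto intro!: sum.neutral simp: indicator_def)
        moreover have "indicator {real (A - i)..} y = (0::real)"
          using j0 n assms by (auto simp: indicator_def)
        ultimately show ?thesis using n j0 by simp
      next
        case 3
        then have "?g (real i + y) = 1" using n by (intro grid_prob_ge[OF t A]) linarith
        moreover have "(\<Sum>j<A. ?g (real j) * indicator {of_int (int j - int i)} y) = 0"
          using 3 n by (intro sum.neutral) (auto simp: indicator_def)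
        moreover have "indicator {real (A - i)..} y = (1::real)"
          using 3 n assms by (auto simp: indicator_def of_nat_diff)
        ultimately show ?thesis by simp
      qed
    qed
    note [measurable] = measurable_grid_prob[OF t A]
    show "(\<lambda>y. ?g (real i + y)) \<in> borel_measurable (law ?h)" by measurable
    show "(\<lambda>y. (\<Sum>j<A. ?g (real j) * indicator {of_int (int j - int i)} y) + 1 * indicator {real (A - i)..} y) \<in> borel_measurable (law ?h)"
      by measurable
  qed
  also have "\<dots> = (\<Sum>j<A. LINT y|law ?h. ?g (real j) * indicator {of_int (int j - int i)} y) + (LINT y|law ?h. 1 * indicator {real (A - i)..} y)"
    using I by (simp only: Bochner_Integration.integral_add Bochner_Integration.integral_sum Bochner_Integration.integrable_sum
       atLeast_borel borel_singleton sets.empty_sets borel_closed closed_singleton)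
  also have "\<dots> = (\<Sum>j<A. ?g (real j) * ?m {of_int (int j - int i)}) + ?m {real (A - i)..}"
    by simp
  finally have E: "(\<Sum>j<A. ?g (real j) * ?m {of_int (int j - int i)}) + ?m {real (A - i)..} - ?g (real i) = 0"
    by simp
  have "(\<Sum>j<A. ?g (real j) * of_bool (int j - int i = 0)) = ?g (real i)"
    using assms by (subst sum.remove[of _ i]) (auto intro!: sum.neutral)
  with E have "(\<Sum>j<A. ?g (real j) * (?m {of_int (int j - int i)} - of_bool (int j - int i = 0))) + ?m {real (A - i)..} = 0"
    by (simp only: right_diff_distrib sum_subtractf)
  then have "((\<Sum>j<A. ?g (real j) * (?m {of_int (int j - int i)} - of_bool (int j - int i = 0))) + ?m {real (A - i)..}) * Suc k = 0"
    by simp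
  then show ?thesis
    unfolding distrib_right sum_distrib_right mult.assoc .
qed

lemma exit_prob_end: "1 \<le> A \<Longrightarrow> exit_prob (real A) (real A) = 1"
proof -
  assume "1 \<le> A"
  then have "(\<lambda>k. grid_prob (1 / Suc k) (real A) (real A)) = (\<lambda>_. 1)"
    by (intro ext grid_prob_ge) auto
  with grid_prob_tendsto_exit_prob[of "real A" "real A"] \<open>1 \<le> A\<close> show ?thesis
    by (simp add: LIMSEQ_const_iff del: of_nat_Suc)
qed

text \<open>The limit of \<open>grid_prob_equation\<close> for vanishing mesh: there the rates
  become the masses of \<open>lam\<close>, and upward jumps of size at least 2 drop out.\<close>

lemma exit_prob_harmonic:
  assumes "i < A"
  shows "measure lam UNIV * exit_prob (real A) (real i)
    = measure lam {1} * exit_prob (real A) (real (Suc i))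
      + (\<Sum>l\<le>i. neg_mass l * exit_prob (real A) (real (i - l)))"
proof -
  let ?u = "\<lambda>j. exit_prob (real A) (real j)" and ?g = "measure lam UNIV"
  have A: "0 < real A" using assms by simp
  have "(\<lambda>k. (\<Sum>j<A. grid_prob (1 / Suc k) (real A) (real j) *
      ((measure (law (1 / Suc k)) {of_int (int j - int i)} - of_bool (int j - int i = 0)) * Suc k))
    + measure (law (1 / Suc k)) {real (A - i)..} * Suc k)
    \<longlonglongrightarrow> (\<Sum>j<A. ?u j * (measure lam {of_int (int j - int i)} - ?g * of_bool (int j - int i = 0)))
       + of_bool (A - i = 1) * measure lam {1}"
    using assms
    by (intro tendsto_add tendsto_sum tendsto_mult small_time_atom small_time_tail grid_prob_tendsto_exit_prob A) auto
  then have "(\<Sum>j<A. ?u j * (measure lam {of_int (int j - int i)} - ?g * of_bool (int j - int i = 0)))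
       + of_bool (A - i = 1) * measure lam {1} = 0"
    unfolding grid_prob_equation[OF assms] by (simp add: LIMSEQ_const_iff)
  moreover have "(\<Sum>j<A. ?u j * (?g * of_bool (int j - int i = 0))) = ?g * ?u i"
    using assms by (subst sum.remove[of _ i]) (auto intro!: sum.neutral)
  ultimately have E: "?g * ?u i = (\<Sum>j<A. ?u j * measure lam {of_int (int j - int i)}) + of_bool (A - i = 1) * measure lam {1}"
    by (simp add: right_diff_distrib sum_subtractf)
  have S: "(\<Sum>j<A. ?u j * measure lam {of_int (int j - int i)})
     = (\<Sum>l\<le>i. neg_mass l * ?u (i - l)) + (\<Sum>j\<in>{Suc i..<A}. ?u j * measure lam {of_int (int j - int i)})"
  proof -
    have split: "{..<A} = {..i} \<union> {Suc i..<A}" using assms by auto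
    have "(\<Sum>j<A. ?u j * measure lam {of_int (int j - int i)})
      = (\<Sum>j\<le>i. ?u j * measure lam {of_int (int j - int i)}) + (\<Sum>j\<in>{Suc i..<A}. ?u j * measure lam {of_int (int j - int i)})"
      unfolding split by (rule sum.union_disjoint) auto
    also have "(\<Sum>j\<le>i. ?u j * measure lam {of_int (int j - int i)}) = (\<Sum>l\<le>i. neg_mass l * ?u (i - l))"
      by (rule sum.reindex_bij_witness[of _ "\<lambda>l. i - l" "\<lambda>j. i - j"]) (auto simp: of_nat_diff)
    finally show ?thesis .
  qed
  \<comment> \<open>The unit upward jump lands either inside the strip or exactly on
    \<open>A\<close>, where the exit probability is 1; both cases give the same term.\<close>
  have T: "(\<Sum>j\<in>{Suc i..<A}. ?u j * measure lam {of_int (int j - int i)}) + of_bool (A - i = 1) * measure lam {1}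
     = measure lam {1} * ?u (Suc i)"
  proof (cases "Suc i = A")
    case True
    then show ?thesis using exit_prob_end[of A] by auto
  next
    case False
    with assms have "Suc i < A" by simp
    then have "(\<Sum>j\<in>{Suc i..<A}. ?u j * measure lam {of_int (int j - int i)}) = ?u (Suc i) * measure lam {1}"
      using measure_lam_ge2
      by (subst sum.remove[of _ "Suc i"]) (auto intro!: sum.neutral simp del: of_int_diff)
    with \<open>Suc i < A\<close> show ?thesis by simp
  qed
  show ?thesis using E S T by linarith
qed

abbreviation scale_seq :: "nat \<Rightarrow> real" where
  "scale_seq \<equiv> renewal_seq (measure lam {1}) (measure lam UNIV) neg_mass"

text \<open>The system leaves \<open>u 0\<close> free and the boundary value 1 at \<open>A\<close>
  fixes it through \<open>u 0 * scale_seq A = 1\<close>. As \<open>u 0\<close> is a probability,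
  this also gives the sign of \<open>scale_seq A\<close>.\<close>

lemma exit_prob_eq:
  assumes "1 \<le> A" "i \<le> A"
  shows "0 < scale_seq A" "exit_prob (real A) (real i) = scale_seq i / scale_seq A"
proof -
  let ?u = "\<lambda>j. exit_prob (real A) (real j)"
  have u: "?u j = ?u 0 * scale_seq j" if "j \<le> A" for j
  proof (rule renewal_seq_unique[where u="?u" and A=A])
    show "measure lam {1} \<noteq> 0" using measure_lam_one_pos by simp
    show "measure lam UNIV * ?u i = measure lam {1} * ?u (Suc i) + (\<Sum>l\<le>i. neg_mass l * ?u (i - l))" if "i < A" for i
      using that by (rule exit_prob_harmonic)
  qed (rule that)
  have uA: "?u 0 * scale_seq A = 1" using u[of A] exit_prob_end[OF assms(1)] by (simp only: order_refl)
  have "0 \<le> ?u 0" unfolding exit_prob_def by (rule measure_nonneg)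
  show pos: "0 < scale_seq A"
  proof (rule ccontr)
    assume "\<not> 0 < scale_seq A"
    then have "?u 0 * scale_seq A \<le> 0"
      using \<open>0 \<le> ?u 0\<close> by (intro mult_nonneg_nonpos) linarith+
    with uA show False by linarith
  qed
  have "?u i * scale_seq A = scale_seq i * (?u 0 * scale_seq A)"
    unfolding u[OF assms(2)] by (simp only: mult_ac)
  with pos show "?u i = scale_seq i / scale_seq A"
    unfolding uA by (simp only: eq_divide_eq mult_1_right) simp
qed

lemma scale_seq_pos: "0 < scale_seq n"
  using exit_prob_eq(1)[of n n] by (cases n) auto

lemma prob_D1_le_eq_scale_seq: "prob_D1_le M X (real n) = scale_seq n / scale_seq (Suc n)"
  using exit_prob_eq(2)[of "Suc n" n] prob_D1_le_eq[of "real n"] by (simp add: add.commute)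

text \<open>The quotient of the two sides is an exit probability.\<close>

lemma scale_seq_mono: "scale_seq n \<le> scale_seq (Suc n)"
proof -
  have "exit_prob (real (Suc n)) (real n) \<le> 1"
    unfolding exit_prob_def by (rule prob_space.prob_le_1[OF prob_space_completion])
  then have "scale_seq n / scale_seq (Suc n) \<le> 1"
    using exit_prob_eq(2)[of "Suc n" n] by (simp del: renewal_seq.simps of_nat_Suc)
  then show ?thesis
    using scale_seq_pos[of "Suc n"] by (simp del: renewal_seq.simps)
qed

lemma unnormalized_scale_eq: "unnormalized_scale M X x = scale_seq (nat \<lfloor>x\<rfloor>)"
proof -
  have "(\<Prod>r = 1..n. prob_D1_le M X (real r - 1)) = 1 / scale_seq n" for n
  proof (induction n)
    case (Suc n)
    then show ?case
      using scale_seq_pos[of n] scale_seq_pos[of "Suc n"]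
      by (simp add: prob_D1_le_eq_scale_seq del: renewal_seq.simps(2))
  qed simp
  then show ?thesis unfolding unnormalized_scale_def by simp
qed

end

section \<open>Generating functions\<close>

lemma renewal_seq_rec:
  "a \<noteq> 0 \<Longrightarrow> a * renewal_seq a g m (Suc n) = g * renewal_seq a g m n - (\<Sum>l\<le>n. m l * renewal_seq a g m (n - l))"
  by simp

text \<open>Once the series converges, the recursion and a Cauchy product give its sum. For
  convergence, replacing the truncated sums in the recursion for \<open>S\<close> by full ones goes
  the wrong way, since they are subtracted. Instead the combinations \<open>D\<close> are bounded,
  which increase because the sequence does.\<close>

lemma renewal_seq_generating_function:
  fixes a g z :: real and m :: "nat \<Rightarrow> real"
  assumes a: "0 < a" and m: "\<And>l. 0 \<le> m l" "m sums (g - a)"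
    and mono: "\<And>n. renewal_seq a g m n \<le> renewal_seq a g m (Suc n)"
    and z: "0 < z" "z < 1" and mz: "(\<lambda>l. m l * z ^ l) sums \<mu>" and \<Psi>: "0 < a / z + \<mu> - g"
  shows "(\<lambda>n. renewal_seq a g m n * z ^ n) sums (a / (z * (a / z + \<mu> - g)))"
proof -
  define w where "w = renewal_seq a g m"
  define S where "S N = (\<Sum>n<N. w n * z ^ n)" for N
  \<comment> \<open>A partial sum of the generating function of the increments
    \<open>w n - w (n - 1)\<close>, with first term 1.\<close>
  define D where "D N = S (Suc N) - z * S N" for N
  have w0: "w 0 = 1" by (simp add: w_def)
  have rec: "a * w (Suc n) = g * w n - (\<Sum>l\<le>n. m l * w (n - l))" for n
    unfolding w_def by (rule renewal_seq_rec) (use a in simp)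
  have w_pos: "0 < w n" for n
  proof (induction n)
    case (Suc n)
    then show ?case using mono[of n] unfolding w_def by (rule less_le_trans)
  qed (simp add: w0)
  have S_Suc: "S (Suc N) = S N + w N * z ^ N" for N by (simp add: S_def)
  have S0: "S 0 = 0" by (simp add: S_def)
  have D_diff: "D (Suc N) = D N + (w (Suc N) - w N) * z ^ Suc N" for N
    unfolding D_def S_Suc[of "Suc N"] S_Suc[of N] by (simp add: algebra_simps)
  have D_mono: "M \<le> N \<Longrightarrow> D M \<le> D N" for M N
  proof (rule lift_Suc_mono_le[of D])
    show "D n \<le> D (Suc n)" for n
      using mono[of n] z unfolding D_diff w_def by simp
  qed
  have "D 0 = 1" by (simp add: D_def S_Suc S0 w0)
  then have D_nonneg: "0 \<le> D N" for N using D_mono[of 0 N] by simp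
  have conv: "(\<Sum>l<Suc N. m l * z ^ l * S (Suc N - l)) = (\<Sum>l<N. m l * z ^ l * S (N - l)) + (\<Sum>l\<le>N. m l * w (N - l)) * z ^ N" for N
  proof -
    have "(\<Sum>l<Suc N. m l * z ^ l * S (Suc N - l)) = (\<Sum>l<Suc N. m l * z ^ l * S (N - l) + m l * w (N - l) * z ^ N)"
    proof (rule sum.cong)
      fix l assume "l \<in> {..<Suc N}"
      then have l: "l \<le> N" by simp
      then have "z ^ N = z ^ l * z ^ (N - l)" by (simp add: power_add[symmetric])
      with l show "m l * z ^ l * S (Suc N - l) = m l * z ^ l * S (N - l) + m l * w (N - l) * z ^ N"
        by (simp add: Suc_diff_le S_Suc algebra_simps)
    qed simp
    also have "\<dots> = (\<Sum>l<Suc N. m l * z ^ l * S (N - l)) + (\<Sum>l<Suc N. m l * w (N - l)) * z ^ N"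
      by (simp only: sum.distrib sum_distrib_right)
    also have "(\<Sum>l<Suc N. m l * z ^ l * S (N - l)) = (\<Sum>l<N. m l * z ^ l * S (N - l))"
      by (simp add: S0)
    finally show ?thesis by (simp only: lessThan_Suc_atMost)
  qed
  have SI: "a * (S (Suc N) - 1) = g * z * S N - z * (\<Sum>l<N. m l * z ^ l * S (N - l))" for N
  proof (induction N)
    case 0
    then show ?case by (simp add: S_Suc S0 w0)
  next
    case (Suc N)
    have "a * (S (Suc (Suc N)) - 1) = a * (S (Suc N) - 1) + a * w (Suc N) * z ^ Suc N"
      by (simp add: S_Suc[of "Suc N"] algebra_simps)
    also have "\<dots> = g * z * (S N + w N * z ^ N) - z * ((\<Sum>l<N. m l * z ^ l * S (N - l)) + (\<Sum>l\<le>N. m l * w (N - l)) * z ^ N)"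
      unfolding Suc.IH rec by (simp add: algebra_simps)
    finally show ?case unfolding conv S_Suc[of N] .
  qed
  \<comment> \<open>As the \<open>m l\<close> sum to \<open>g - a\<close>, the left side is
    \<open>z\<close> times the sum of \<open>m l * (S N - z ^ l * S (N - l))\<close>. Each
    difference telescopes into values of \<open>D\<close> weighted by powers of \<open>z\<close>,
    all at most \<open>D N\<close>. For \<open>l > N\<close> truncated subtraction is harmless
    because \<open>S 0 = 0\<close>.\<close>
  have DI: "a * (D N - 1) \<le> z * (D N * ((g - a - \<mu>) / (1 - z)))" for N
  proof -
    have fin: "(\<lambda>l. m l * z ^ l * S (N - l)) sums (\<Sum>l<N. m l * z ^ l * S (N - l))"
      by (rule sums_finite) (auto simp: S0)
    have s1: "(\<lambda>l. m l * S N - m l * z ^ l * S (N - l)) sums ((g - a) * S N - (\<Sum>l<N. m l * z ^ l * S (N - l)))"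
      using m(2) fin by (intro sums_diff sums_mult2)
    have s2: "(\<lambda>l. D N / (1 - z) * (m l - m l * z ^ l)) sums (D N / (1 - z) * (g - a - \<mu>))"
      using m(2) mz by (intro sums_mult sums_diff)
    have tel: "S N - z ^ l * S (N - l) \<le> D N * ((1 - z ^ l) / (1 - z))" for l
    proof (induction l)
      case (Suc l)
      have "S (N - l) - z * S (N - Suc l) \<le> D N"
      proof (cases "l < N")
        case True
        then have "S (N - l) - z * S (N - Suc l) = D (N - Suc l)"
          by (simp add: D_def Suc_diff_Suc)
        also have "\<dots> \<le> D N" by (rule D_mono) simp
        finally show ?thesis .
      qed (simp add: S0 D_nonneg)
      then have "z ^ l * (S (N - l) - z * S (N - Suc l)) \<le> z ^ l * D N"
        using z by (intro mult_left_mono) auto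
      with Suc have "S N - z ^ Suc l * S (N - Suc l) \<le> D N * ((1 - z ^ l) / (1 - z)) + z ^ l * D N"
        by (simp add: algebra_simps)
      also have "\<dots> = D N * ((1 - z ^ Suc l) / (1 - z))"
        using z by (simp add: field_simps)
      finally show ?case .
    qed simp
    have "(g - a) * S N - (\<Sum>l<N. m l * z ^ l * S (N - l)) \<le> D N / (1 - z) * (g - a - \<mu>)"
    proof (rule sums_le[OF _ s1 s2])
      fix l
      show "m l * S N - m l * z ^ l * S (N - l) \<le> D N / (1 - z) * (m l - m l * z ^ l)"
        using mult_left_mono[OF tel m(1), of l l]
        by (simp add: right_diff_distrib diff_divide_distrib mult_ac)
    qed
    then have "z * ((g - a) * S N - (\<Sum>l<N. m l * z ^ l * S (N - l))) \<le> z * (D N * ((g - a - \<mu>) / (1 - z)))"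
      using z by (intro mult_left_mono) auto
    moreover have "a * (D N - 1) = z * ((g - a) * S N - (\<Sum>l<N. m l * z ^ l * S (N - l)))"
      using SI[of N] by (simp add: D_def algebra_simps)
    ultimately show ?thesis by simp
  qed
  let ?\<Psi> = "a / z + \<mu> - g"
  \<comment> \<open>Solves \<open>DI\<close> for \<open>D N\<close>: after multiplication by
    \<open>1 - z\<close> the coefficient of \<open>D N\<close> is \<open>z * ?\<Psi> > 0\<close>.
    The bound \<open>C / (1 - z)\<close> obtained for \<open>S\<close> is already the value of the
    series.\<close>
  define C where "C = a * (1 - z) / (z * ?\<Psi>)"
  have DC: "D N \<le> C" for N
  proof -
    have "a * (D N - 1) * (1 - z) \<le> z * (D N * ((g - a - \<mu>) / (1 - z))) * (1 - z)"
      using z by (intro mult_right_mono DI) simp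
    also have "\<dots> = z * D N * (g - a - \<mu>)" using z by simp
    finally have "D N * (a + z * \<mu> - z * g) \<le> a * (1 - z)" by (simp add: algebra_simps)
    moreover have "z * ?\<Psi> = a + z * \<mu> - z * g" using z by (simp add: field_simps)
    ultimately have "D N * (z * ?\<Psi>) \<le> a * (1 - z)" by simp
    then show ?thesis unfolding C_def using z \<Psi> by (simp add: pos_le_divide_eq)
  qed
  have SC: "S N \<le> C / (1 - z)" for N
  proof (induction N)
    case 0
    then show ?case unfolding S0 C_def using a z \<Psi> by (intro divide_nonneg_pos mult_nonneg_nonneg) auto
  next
    case (Suc N)
    have "S (Suc N) = D N + z * S N" by (simp add: D_def)
    also have "\<dots> \<le> C + z * (C / (1 - z))"
      using Suc z by (intro add_mono DC mult_left_mono) auto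
    also have "\<dots> = C / (1 - z)" using z by (simp add: field_simps)
    finally show ?case .
  qed
  have w_summable: "summable (\<lambda>n. w n * z ^ n)"
    by (rule summableI_nonneg_bounded[where x="C / (1 - z)"])
       (use w_pos z SC in \<open>auto simp: S_def intro: less_imp_le\<close>)
  define F where "F = (\<Sum>n. w n * z ^ n)"
  have F: "(\<lambda>n. w n * z ^ n) sums F" unfolding F_def using w_summable by (rule summable_sums)
  have "(\<lambda>n. \<Sum>l\<le>n. (m l * z ^ l) * (w (n - l) * z ^ (n - l))) sums ((\<Sum>l. m l * z ^ l) * (\<Sum>n. w n * z ^ n))"
    using w_summable sums_summable[OF mz] w_pos m(1) z
    by (intro Cauchy_product_sums) (auto simp: abs_mult less_imp_le)
  also have "(\<Sum>l. m l * z ^ l) = \<mu>" using mz by (rule sums_unique[symmetric])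
  also have "(\<lambda>n. \<Sum>l\<le>n. (m l * z ^ l) * (w (n - l) * z ^ (n - l))) = (\<lambda>n. (\<Sum>l\<le>n. m l * w (n - l)) * z ^ n)"
    unfolding sum_distrib_right
  proof (intro ext sum.cong refl)
    fix n l :: nat assume "l \<in> {..n}"
    then have "z ^ n = z ^ l * z ^ (n - l)" by (simp add: power_add[symmetric])
    then show "(m l * z ^ l) * (w (n - l) * z ^ (n - l)) = m l * w (n - l) * z ^ n" by simp
  qed
  finally have "(\<lambda>n. (\<Sum>l\<le>n. m l * w (n - l)) * z ^ n) sums (\<mu> * F)" by (simp add: F_def)
  from sums_diff[OF sums_mult[OF F, of "g * z"] sums_mult[OF this, of z]]
  have "(\<lambda>n. a * w (Suc n) * z ^ Suc n) sums (g * z * F - z * (\<mu> * F))"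
    unfolding rec by (simp add: algebra_simps)
  moreover have "(\<lambda>n. a * w (Suc n) * z ^ Suc n) sums (a * (F - 1))"
    using sums_mult[OF sums_split_initial_segment[OF F, of 1], of a] w0 by (simp add: mult_ac)
  ultimately have "a * (F - 1) = g * z * F - z * (\<mu> * F)" by (rule sums_unique2[symmetric])
  then have "F * (a + z * \<mu> - z * g) = a" by (simp add: algebra_simps)
  moreover have "z * ?\<Psi> = a + z * \<mu> - z * g" using z by (simp add: field_simps)
  ultimately have "F * (z * ?\<Psi>) = a" by simp
  then have "F = a / (z * ?\<Psi>)" using z \<Psi> by (simp add: eq_divide_eq)
  with F show ?thesis by (simp add: w_def)
qed

lemma has_integral_step:
  fixes g :: "real \<Rightarrow> real" and f :: "nat \<Rightarrow> real"
  assumes "\<And>j. (g has_integral I j) {real j..real (Suc j)}"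
  shows "((\<lambda>x. g x * f (nat \<lfloor>x\<rfloor>)) has_integral (\<Sum>j<n. I j * f j)) {0..real n}"
proof (induction n)
  case (Suc n)
  have "((\<lambda>x. g x * f (nat \<lfloor>x\<rfloor>)) has_integral I n * f n) {real n..real (Suc n)}"
  \<comment> \<open>At the right endpoint the floor has already jumped to \<open>n + 1\<close>, so
    this single point is discarded.\<close>
  proof (rule has_integral_spike_finite[where S="{real (Suc n)}" and f="\<lambda>x. g x * f n"])
    show "((\<lambda>x. g x * f n) has_integral I n * f n) {real n..real (Suc n)}"
      using assms by (rule has_integral_mult_left)
    fix x assume "x \<in> {real n..real (Suc n)} - {real (Suc n)}"
    then have "\<lfloor>x\<rfloor> = int n" by (intro floor_unique) auto
    then show "g x * f (nat \<lfloor>x\<rfloor>) = g x * f n" by simp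
  qed simp
  from has_integral_combine[OF _ _ Suc.IH this] show ?case by simp
qed (simp add: has_integral_refl)

section \<open>Laplace transform and normalization of the scale function\<close>

context usf_levy_chain
begin

lemma laplace_integrand:
  assumes "0 \<le> \<beta>"
  shows laplace_integrable: "integrable lam (\<lambda>x. exp (\<beta> * x) - 1)"
    and laplace_sums: "(\<lambda>l. (exp (\<beta> * - real l) - 1) * neg_mass l) sums
      (laplace_exponent lam \<beta> - (exp \<beta> - 1) * measure lam {1})"
proof -
  have bound: "\<bar>exp (\<beta> * x) - 1\<bar> \<le> exp \<beta> + 1" if "x \<le> 1" for x
  proof -
    have "exp (\<beta> * x) \<le> exp \<beta>" using assms that by (simp add: mult_left_le)
    moreover have "0 < exp (\<beta> * x)" by simp
    ultimately show ?thesis by linarith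
  qed
  show "integrable lam (\<lambda>x. exp (\<beta> * x) - 1)"
    by (rule integrable_lam[OF _ bound]) auto
  show "(\<lambda>l. (exp (\<beta> * - real l) - 1) * neg_mass l) sums
      (laplace_exponent lam \<beta> - (exp \<beta> - 1) * measure lam {1})"
    unfolding laplace_exponent_def
    using integral_lam_sums[where f="\<lambda>x. exp (\<beta> * x) - 1", OF _ bound] by simp
qed

text \<open>With \<open>z = exp (- \<beta>)\<close> the expression \<open>a / z + \<mu> - g\<close>
  of the generating function is the Laplace exponent at \<open>\<beta>\<close>.\<close>

lemma scale_seq_sums:
  assumes \<beta>: "0 < \<beta>" and pos: "0 < laplace_exponent lam \<beta>"
  shows "(\<lambda>n. scale_seq n * exp (- \<beta>) ^ n) sums (measure lam {1} * exp \<beta> / laplace_exponent lam \<beta>)"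
proof -
  let ?p = "measure lam {1}" and ?g = "measure lam UNIV" and ?\<psi> = "laplace_exponent lam \<beta>"
  have "(\<lambda>l. (exp (\<beta> * - real l) - 1) * neg_mass l + neg_mass l) sums (?\<psi> - (exp \<beta> - 1) * ?p + (?g - ?p))"
    using laplace_sums[of \<beta>] measure_lam_sums \<beta> by (intro sums_add) auto
  moreover have "(exp (\<beta> * - real l) - 1) * neg_mass l + neg_mass l = neg_mass l * exp (- \<beta>) ^ l" for l
    by (simp add: exp_of_nat_mult[symmetric] algebra_simps)
  ultimately have "(\<lambda>l. neg_mass l * exp (- \<beta>) ^ l) sums (?\<psi> - (exp \<beta> - 1) * ?p + (?g - ?p))"
    by (simp only:)
  also have "?\<psi> - (exp \<beta> - 1) * ?p + (?g - ?p) = ?\<psi> + ?g - exp \<beta> * ?p"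
    by (simp add: algebra_simps)
  finally have mz: "(\<lambda>l. neg_mass l * exp (- \<beta>) ^ l) sums (?\<psi> + ?g - exp \<beta> * ?p)" .
  have e: "?p / exp (- \<beta>) + (?\<psi> + ?g - exp \<beta> * ?p) - ?g = ?\<psi>"
    by (simp add: exp_minus divide_inverse)
  have "(\<lambda>n. scale_seq n * exp (- \<beta>) ^ n) sums (?p / (exp (- \<beta>) * (?p / exp (- \<beta>) + (?\<psi> + ?g - exp \<beta> * ?p) - ?g)))"
    by (rule renewal_seq_generating_function[OF measure_lam_one_pos _ measure_lam_sums scale_seq_mono _ _ mz])
       (use \<beta> pos in \<open>auto simp only: e exp_gt_zero exp_less_one_iff neg_less_0_iff_less measure_nonneg\<close>)
  then show ?thesis unfolding e by (simp add: exp_minus field_simps)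
qed

text \<open>Unit intervals turn the generating function into a Laplace transform, and monotone
  convergence, with \<open>0 \<le> c\<close>, reaches the half line. The outcome is
  \<open>c * measure lam {1}\<close> times the prescribed transform.\<close>

lemma scale_seq_laplace:
  assumes \<beta>: "0 < \<beta>" and pos: "0 < laplace_exponent lam \<beta>" and c: "0 \<le> c"
  shows "((\<lambda>x. exp (- \<beta> * x) * (c * unnormalized_scale M X x)) has_integral
     c * measure lam {1} * ((exp \<beta> - 1) / (\<beta> * laplace_exponent lam \<beta>))) {0..}"
proof -
  define I where "I j = exp (- \<beta>) ^ j * ((1 - exp (- \<beta>)) / \<beta>)" for j
  let ?f = "\<lambda>x. exp (- \<beta> * x) * (c * scale_seq (nat \<lfloor>x\<rfloor>))"
  have int: "((\<lambda>x. exp (- \<beta> * x)) has_integral I j) {real j..real (Suc j)}" for j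
  proof -
    have "((\<lambda>x. exp (- \<beta> * x)) has_integral (- exp (- \<beta> * real (Suc j)) / \<beta> - - exp (- \<beta> * real j) / \<beta>)) {real j..real (Suc j)}"
    proof (rule fundamental_theorem_of_calculus)
      fix x assume "x \<in> {real j..real (Suc j)}"
      show "((\<lambda>x. - exp (- \<beta> * x) / \<beta>) has_vector_derivative exp (- \<beta> * x)) (at x within {real j..real (Suc j)})"
        using \<beta> by (auto intro!: derivative_eq_intros simp: has_real_derivative_iff_has_vector_derivative[symmetric])
    qed simp
    moreover have "- exp (- \<beta> * real (Suc j)) / \<beta> - - exp (- \<beta> * real j) / \<beta> = I j"
    proof -
      have "exp (- \<beta> * real (Suc j)) = exp (- \<beta>) * exp (- \<beta> * real j)"
        by (simp add: exp_add[symmetric] algebra_simps)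
      moreover have "exp (- \<beta> * real j) = exp (- \<beta>) ^ j"
        by (simp add: exp_of_nat_mult[symmetric] mult.commute)
      ultimately show ?thesis using \<beta> by (simp only: I_def) (simp add: field_simps)
    qed
    ultimately show ?thesis by simp
  qed
  have lim: "(\<lambda>n. \<Sum>j<n. I j * (c * scale_seq j)) \<longlonglongrightarrow> c * measure lam {1} * ((exp \<beta> - 1) / (\<beta> * laplace_exponent lam \<beta>))"
  proof -
    have "(\<lambda>j. c * ((1 - exp (- \<beta>)) / \<beta>) * (scale_seq j * exp (- \<beta>) ^ j)) sums
       (c * ((1 - exp (- \<beta>)) / \<beta>) * (measure lam {1} * exp \<beta> / laplace_exponent lam \<beta>))"
      by (intro sums_mult scale_seq_sums \<beta> pos)
    also have "(\<lambda>j. c * ((1 - exp (- \<beta>)) / \<beta>) * (scale_seq j * exp (- \<beta>) ^ j)) = (\<lambda>j. I j * (c * scale_seq j))"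
      by (simp add: I_def mult_ac)
    also have "c * ((1 - exp (- \<beta>)) / \<beta>) * (measure lam {1} * exp \<beta> / laplace_exponent lam \<beta>)
       = c * measure lam {1} * ((exp \<beta> - 1) / (\<beta> * laplace_exponent lam \<beta>))"
    proof -
      have "1 - exp (- \<beta>) = (exp \<beta> - 1) / exp \<beta>" by (simp add: exp_minus field_simps)
      then show ?thesis by simp
    qed
    finally show ?thesis by (simp add: sums_def)
  qed
  have "(?f has_integral c * measure lam {1} * ((exp \<beta> - 1) / (\<beta> * laplace_exponent lam \<beta>))) {0..}"
  proof (rule has_integral_monotone_convergence_increasing[where f="\<lambda>n x. if x \<in> {0..real n} then ?f x else 0", OF _ _ _ lim])
    show "((\<lambda>x. if x \<in> {0..real k} then ?f x else 0) has_integral (\<Sum>j<k. I j * (c * scale_seq j))) {0..}" for k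
      using has_integral_step[OF int] by (subst has_integral_restrict) auto
    show "(if x \<in> {0..real k} then ?f x else 0) \<le> (if x \<in> {0..real (Suc k)} then ?f x else 0)" for k x
      using c scale_seq_pos[of "nat \<lfloor>x\<rfloor>"] by (auto intro!: mult_nonneg_nonneg simp: less_imp_le)
    fix x :: real assume "x \<in> {0..}"
    obtain N where "x \<le> real N" using real_arch_simple by blast
    then show "(\<lambda>k. if x \<in> {0..real k} then ?f x else 0) \<longlonglongrightarrow> ?f x"
      using \<open>x \<in> {0..}\<close> by (intro tendsto_eventually eventually_sequentiallyI[of N]) auto
  qed
  then show ?thesis unfolding unnormalized_scale_eq .
qed

text \<open>The hypothesis puts the largest root at 0, as happens after tilting. The transform is
  linear in the constant, so the single test value \<open>\<beta> = 1\<close> settles the uniqueness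
  required by \<open>THE\<close>.\<close>

lemma scale_function_eq:
  assumes pos: "\<And>\<beta>. 0 < \<beta> \<Longrightarrow> 0 < laplace_exponent lam \<beta>"
  shows "scale_function M X lam x = scale_seq (nat \<lfloor>x\<rfloor>) / measure lam {1}"
proof -
  have zero: "laplace_exponent lam 0 = 0" by (simp add: laplace_exponent_def)
  have root: "largest_root lam = 0"
    unfolding largest_root_def
  proof (rule Greatest_equality)
    fix y :: real assume y: "0 \<le> y \<and> laplace_exponent lam y = 0"
    then show "y \<le> 0" using pos[of y] by (cases "0 < y") auto
  qed (simp add: zero)
  have "scale_const M X lam = 1 / measure lam {1}"
    unfolding scale_const_def root
  proof (rule the_equality, intro conjI allI impI)
    show "0 < 1 / measure lam {1}" using measure_lam_one_pos by simp
    fix \<beta> :: real assume "0 < \<beta>"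
    then show "((\<lambda>x. exp (- \<beta> * x) * (1 / measure lam {1} * unnormalized_scale M X x)) has_integral
       (exp \<beta> - 1) / (\<beta> * laplace_exponent lam \<beta>)) {0..}"
      using scale_seq_laplace[of \<beta> "1 / measure lam {1}"] pos measure_lam_one_pos by simp
  next
    fix c :: real
    assume c: "0 < c \<and> (\<forall>\<beta>>0. ((\<lambda>x. exp (- \<beta> * x) * (c * unnormalized_scale M X x)) has_integral
       (exp \<beta> - 1) / (\<beta> * laplace_exponent lam \<beta>)) {0..})"
    let ?R = "(exp 1 - 1) / (1 * laplace_exponent lam 1) :: real"
    have "((\<lambda>x. exp (- 1 * x) * (c * unnormalized_scale M X x)) has_integral ?R) {0..}"
      using c by (metis zero_less_one)
    moreover have "((\<lambda>x. exp (- 1 * x) * (c * unnormalized_scale M X x)) has_integral c * measure lam {1} * ?R) {0..}"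
      using c by (intro scale_seq_laplace pos) auto
    ultimately have "?R = c * measure lam {1} * ?R" by (rule has_integral_unique)
    moreover have "?R \<noteq> 0" using pos[of 1] by (auto simp: one_less_exp_iff)
    ultimately have "c * measure lam {1} = 1" by simp
    then show "c = 1 / measure lam {1}"
      using measure_lam_one_pos by (simp add: eq_divide_eq)
  qed
  then show ?thesis by (simp add: scale_function_def unnormalized_scale_eq)
qed

end

section \<open>The Laplace exponent and its inverse\<close>

context usf_levy_chain
begin

lemma convex_on_laplace_exponent: "convex_on {0..} (laplace_exponent lam)"
proof (rule convex_onI)
  fix t x y :: real assume t: "0 < t" "t < 1" and xy: "x \<in> {0..}" "y \<in> {0..}"
  have z: "0 \<le> (1 - t) * x + t * y" using t xy by simp
  have "laplace_exponent lam ((1 - t) * x + t * y)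
      \<le> (LINT u|lam. (1 - t) * (exp (x * u) - 1) + t * (exp (y * u) - 1))"
    unfolding laplace_exponent_def
  proof (rule integral_mono)
    show "integrable lam (\<lambda>u. exp (((1 - t) * x + t * y) * u) - 1)" by (rule laplace_integrable[OF z])
    show "integrable lam (\<lambda>u. (1 - t) * (exp (x * u) - 1) + t * (exp (y * u) - 1))"
      using laplace_integrable[of x] laplace_integrable[of y] xy by auto
    fix u
    have "exp ((1 - t) *\<^sub>R (x * u) + t *\<^sub>R (y * u)) \<le> (1 - t) * exp (x * u) + t * exp (y * u)"
      by (rule convex_onD[OF exp_convex]) (use t in auto)
    then show "exp (((1 - t) * x + t * y) * u) - 1 \<le> (1 - t) * (exp (x * u) - 1) + t * (exp (y * u) - 1)"
      by (simp add: algebra_simps)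
  qed
  also have "\<dots> = (1 - t) * laplace_exponent lam x + t * laplace_exponent lam y"
    unfolding laplace_exponent_def using laplace_integrable[of x] laplace_integrable[of y] xy
    by (subst Bochner_Integration.integral_add) auto
  finally show "laplace_exponent lam ((1 - t) *\<^sub>R x + t *\<^sub>R y)
      \<le> (1 - t) * laplace_exponent lam x + t * laplace_exponent lam y"
    by simp
qed simp

lemma continuous_on_laplace_exponent: "continuous_on {0..} (laplace_exponent lam)"
  unfolding continuous_on_sequentially comp_def
proof (intro allI ballI impI, elim conjE)
  fix x :: "nat \<Rightarrow> real" and a assume a: "a \<in> {0..}" and x: "\<forall>n. x n \<in> {0..}" and lim: "x \<longlonglongrightarrow> a"
  from convergent_imp_Bseq[of x] lim obtain B where B: "\<And>n. norm (x n) \<le> B"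
    by (auto simp: Bseq_def convergent_def)
  have B0: "0 \<le> B" using B[of 0] by (rule order_trans[OF norm_ge_zero])
  show "(\<lambda>n. laplace_exponent lam (x n)) \<longlonglongrightarrow> laplace_exponent lam a"
    unfolding laplace_exponent_def
  proof (rule integral_dominated_convergence[where w="\<lambda>_. exp B + 1"])
    show "AE u in lam. (\<lambda>n. exp (x n * u) - 1) \<longlonglongrightarrow> exp (a * u) - 1"
      by (intro AE_I2 tendsto_intros lim)
    show "AE u in lam. norm (exp (x n * u) - 1) \<le> exp B + 1" for n
      using AE_lam
    proof eventually_elim
      case (elim u)
      then have "u \<le> 1" by auto
      then have "x n * u \<le> x n * 1" using x by (intro mult_left_mono) auto
      with B[of n] have "x n * u \<le> B" by simp
      then have "exp (x n * u) \<le> exp B" by simp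
      moreover have "0 < exp (x n * u)" by simp
      ultimately show ?case unfolding real_norm_def by linarith
    qed
  qed auto
qed

lemma laplace_exponent_zero: "laplace_exponent lam 0 = 0"
  by (simp add: laplace_exponent_def)

text \<open>A downward jump contributes at least minus its mass; all growth comes from the upward
  jump.\<close>

lemma laplace_exponent_ge:
  assumes "0 \<le> \<beta>"
  shows "(exp \<beta> - 1) * measure lam {1} - measure lam UNIV \<le> laplace_exponent lam \<beta>"
proof -
  have "- (measure lam UNIV - measure lam {1}) \<le> laplace_exponent lam \<beta> - (exp \<beta> - 1) * measure lam {1}"
  proof (rule sums_le[OF _ sums_minus[OF measure_lam_sums] laplace_sums[OF assms]])
    fix l
    have "- 1 * neg_mass l \<le> (exp (\<beta> * - real l) - 1) * neg_mass l"
      by (intro mult_right_mono) auto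
    then show "- neg_mass l \<le> (exp (\<beta> * - real l) - 1) * neg_mass l" by simp
  qed
  then show ?thesis using measure_lam_one_pos by linarith
qed

lemma laplace_exponent_exceeds: "\<exists>\<beta>\<ge>b. q < laplace_exponent lam \<beta>"
proof -
  \<comment> \<open>Chosen so that \<open>c * measure lam {1}\<close> exceeds \<open>q\<close> plus
    the total mass, the amount to be beaten in \<open>laplace_exponent_ge\<close>.\<close>
  define c where "c = (q + measure lam UNIV) / measure lam {1} + 1"
  define \<beta> where "\<beta> = max 0 (max b (ln (1 + \<bar>c\<bar>)))"
  have "1 + \<bar>c\<bar> = exp (ln (1 + \<bar>c\<bar>))" by simp
  also have "\<dots> \<le> exp \<beta>" unfolding exp_le_cancel_iff by (simp add: \<beta>_def)
  finally have "c \<le> exp \<beta> - 1" by linarith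
  then have "c * measure lam {1} \<le> (exp \<beta> - 1) * measure lam {1}" by (rule mult_right_mono) simp
  moreover have "q + measure lam UNIV < c * measure lam {1}"
    unfolding c_def distrib_right[of _ 1] using measure_lam_one_pos by simp
  moreover have "0 \<le> \<beta>" "b \<le> \<beta>" by (auto simp: \<beta>_def)
  ultimately show ?thesis using laplace_exponent_ge[of \<beta>] by (intro exI[of _ \<beta>]) linarith
qed

text \<open>\<open>GREATEST\<close> is informative only once a greatest root is exhibited: the roots
  in \<open>[0, b]\<close> form a compact set, and there are none beyond \<open>b\<close>. Above the
  largest root a nonpositive value would force yet another root by the intermediate value
  theorem.\<close>

lemma
  shows largest_root_nonneg: "0 \<le> largest_root lam"
    and laplace_exponent_largest_root: "laplace_exponent lam (largest_root lam) = 0"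
    and laplace_exponent_pos: "\<And>\<beta>. largest_root lam < \<beta> \<Longrightarrow> 0 < laplace_exponent lam \<beta>"
proof -
  let ?\<psi> = "laplace_exponent lam"
  obtain b where b: "0 \<le> b" "0 < ?\<psi> b" using laplace_exponent_exceeds[of 0 0] by blast
  have ivt: "\<exists>y. x \<le> y \<and> ?\<psi> y = 0" if x: "0 \<le> x" "?\<psi> x \<le> 0" for x
  proof -
    obtain b where b: "x \<le> b" "0 < ?\<psi> b" using laplace_exponent_exceeds[of x 0] by blast
    have "\<exists>y\<ge>x. y \<le> b \<and> ?\<psi> y = 0"
      using x b by (intro IVT' continuous_on_subset[OF continuous_on_laplace_exponent]) auto
    then show ?thesis by blast
  qed
  \<comment> \<open>By convexity and \<open>\<psi> 0 = 0\<close>, the exponent stays positive once it is positive.\<close>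
  have pos: "0 < ?\<psi> y" if "0 \<le> x" "x \<le> y" "0 < ?\<psi> x" for x y
  proof (cases "0 < x")
    case True
    define t where "t = x / y"
    have t: "0 < t" "t \<le> 1" "t * y = x" using True that by (auto simp: t_def)
    have "?\<psi> ((1 - t) *\<^sub>R 0 + t *\<^sub>R y) \<le> (1 - t) * ?\<psi> 0 + t * ?\<psi> y"
      using that t by (intro convex_onD[OF convex_on_laplace_exponent]) auto
    then have "0 < t * ?\<psi> y" using t that by (simp add: laplace_exponent_zero)
    then show ?thesis using t by (simp add: zero_less_mult_iff)
  next
    case False
    then have "x = 0" using that by simp
    then show ?thesis using that laplace_exponent_zero by simp
  qed
  define R where "R = {x \<in> {0..b}. ?\<psi> x = 0}"
  have "closed R"
    unfolding R_def
    by (intro continuous_closed_preimage_constant continuous_on_subset[OF continuous_on_laplace_exponent]) auto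
  moreover have "bounded R" by (rule bounded_subset[of "{0..b}"]) (auto simp: R_def)
  ultimately have "compact R" by (simp add: compact_eq_bounded_closed)
  moreover have "R \<noteq> {}" using b laplace_exponent_zero by (auto simp: R_def)
  ultimately obtain r where r: "r \<in> R" "\<And>y. y \<in> R \<Longrightarrow> y \<le> r"
    using compact_attains_sup[of R] by blast
  have r_max: "y \<le> r" if "0 \<le> y" "?\<psi> y = 0" for y
  proof (rule r(2), cases "y \<le> b")
    case True
    then show "y \<in> R" using that by (simp add: R_def)
  next
    case False
    then show "y \<in> R" using pos[of b y] b that by simp
  qed
  have eq: "largest_root lam = r"
    unfolding largest_root_def
  proof (rule Greatest_equality)
    show "0 \<le> r \<and> ?\<psi> r = 0" using r(1) by (simp add: R_def)
  qed (use r_max in blast)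
  show "0 \<le> largest_root lam" "?\<psi> (largest_root lam) = 0"
    using r(1) unfolding eq by (auto simp: R_def)
  fix \<beta> assume "largest_root lam < \<beta>"
  show "0 < ?\<psi> \<beta>"
  proof (rule ccontr)
    assume "\<not> 0 < ?\<psi> \<beta>"
    with ivt[of \<beta>] obtain y where "\<beta> \<le> y" "?\<psi> y = 0"
      using \<open>0 \<le> largest_root lam\<close> \<open>largest_root lam < \<beta>\<close> by auto
    moreover from this have "y \<le> r"
      using \<open>largest_root lam < \<beta>\<close> \<open>0 \<le> largest_root lam\<close> by (intro r_max) linarith+
    ultimately show False using \<open>largest_root lam < \<beta>\<close> eq by simp
  qed
qed

text \<open>A point strictly between the largest root and \<open>y\<close> is a convex combination
  with weight \<open>t < 1\<close> on \<open>y\<close>; as the exponent vanishes at the root,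
  convexity bounds its value by \<open>t\<close> times the positive value at
  \<open>y\<close>.\<close>

lemma laplace_exponent_strict_mono:
  assumes "largest_root lam \<le> x" "x < y"
  shows "laplace_exponent lam x < laplace_exponent lam y"
proof (cases "largest_root lam = x")
  case True
  then show ?thesis using laplace_exponent_pos[of y] laplace_exponent_largest_root assms by simp
next
  case False
  let ?r = "largest_root lam" and ?\<psi> = "laplace_exponent lam"
  define t where "t = (x - ?r) / (y - ?r)"
  have "t * (y - ?r) = x - ?r" using assms by (simp add: t_def)
  then have "(1 - t) * ?r + t * y = x" by (simp add: algebra_simps)
  moreover have "0 < t" "t < 1" using False assms by (auto simp: t_def)
  ultimately have t: "0 < t" "t < 1" "(1 - t) * ?r + t * y = x" by blast+
  have "?\<psi> ((1 - t) *\<^sub>R ?r + t *\<^sub>R y) \<le> (1 - t) * ?\<psi> ?r + t * ?\<psi> y"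
    using assms t largest_root_nonneg by (intro convex_onD[OF convex_on_laplace_exponent]) auto
  then have "?\<psi> x \<le> t * ?\<psi> y" using t by (simp add: laplace_exponent_largest_root)
  also have "\<dots> < 1 * ?\<psi> y"
    using t assms laplace_exponent_pos[of y] by (intro mult_strict_right_mono) auto
  finally show ?thesis by simp
qed

lemma
  assumes "0 \<le> q"
  shows Phi_ge: "largest_root lam \<le> Phi lam q"
    and laplace_exponent_Phi: "laplace_exponent lam (Phi lam q) = q"
proof -
  let ?r = "largest_root lam" and ?\<psi> = "laplace_exponent lam"
  have inj: "inj_on ?\<psi> {?r..}"
    by (rule linorder_inj_onI) (use laplace_exponent_strict_mono in force)+
  obtain b where b: "?r \<le> b" "q < ?\<psi> b" using laplace_exponent_exceeds[of ?r q] by blast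
  have "\<exists>y\<ge>?r. y \<le> b \<and> ?\<psi> y = q"
    using assms b laplace_exponent_largest_root largest_root_nonneg
    by (intro IVT' continuous_on_subset[OF continuous_on_laplace_exponent]) auto
  then have q: "q \<in> ?\<psi> ` {?r..}" by auto
  show "?r \<le> Phi lam q"
    using the_inv_into_into[OF inj q order_refl] by (simp add: Phi_def)
  show "?\<psi> (Phi lam q) = q"
    unfolding Phi_def by (rule f_the_inv_into_f[OF inj q])
qed

section \<open>Exponential tilting of the Levy measure\<close>

lemma measure_tilt_singleton: "measure (tilt b lam) {y} = exp (b * y) * measure lam {y}"
proof -
  have "emeasure (tilt b lam) {y} = (\<integral>\<^sup>+x. ennreal (exp (b * x)) * indicator {y} x \<partial>lam)"
    unfolding tilt_def by (rule emeasure_density) auto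
  also have "\<dots> = (\<integral>\<^sup>+x. ennreal (exp (b * y)) * indicator {y} x \<partial>lam)"
    by (intro nn_integral_cong) (auto simp: indicator_def)
  also have "\<dots> = ennreal (exp (b * y)) * emeasure lam {y}"
    by (rule nn_integral_cmult_indicator) simp
  finally show ?thesis by (simp add: measure_def enn2real_mult)
qed

lemma
  assumes b: "0 \<le> b"
  shows measure_tilt_UNIV: "measure (tilt b lam) UNIV = measure lam UNIV + laplace_exponent lam b"
    and laplace_exponent_tilt: "0 \<le> \<beta> \<Longrightarrow>
      laplace_exponent (tilt b lam) \<beta> = laplace_exponent lam (\<beta> + b) - laplace_exponent lam b"
proof -
  have density: "(LINT x|tilt b lam. f x) = (LINT x|lam. exp (b * x) * f x)"
    if "f \<in> borel_measurable borel" for f :: "real \<Rightarrow> real"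
    unfolding tilt_def using that
    by (subst integral_density) (auto simp: measurable_cong_sets[OF sets_lam refl])
  have "measure (tilt b lam) UNIV = (LINT x|tilt b lam. 1)"
    by (simp add: tilt_def)
  also have "\<dots> = (LINT x|lam. (exp (b * x) - 1) + 1)" by (subst density) auto
  also have "\<dots> = (LINT x|lam. exp (b * x) - 1) + (LINT x|lam. 1)"
    using laplace_integrable[OF b] by (intro Bochner_Integration.integral_add) auto
  finally show "measure (tilt b lam) UNIV = measure lam UNIV + laplace_exponent lam b"
    by (simp add: laplace_exponent_def)
  assume "0 \<le> \<beta>"
  have "laplace_exponent (tilt b lam) \<beta> = (LINT x|lam. exp (b * x) * (exp (\<beta> * x) - 1))"
    unfolding laplace_exponent_def by (rule density) auto
  also have "\<dots> = (LINT x|lam. (exp ((\<beta> + b) * x) - 1) - (exp (b * x) - 1))"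
    by (intro Bochner_Integration.integral_cong) (auto simp: algebra_simps exp_add)
  also have "\<dots> = laplace_exponent lam (\<beta> + b) - laplace_exponent lam b"
    unfolding laplace_exponent_def using laplace_integrable[OF b] laplace_integrable[of "\<beta> + b"] b \<open>0 \<le> \<beta>\<close>
    by (intro Bochner_Integration.integral_diff) auto
  finally show "laplace_exponent (tilt b lam) \<beta> = laplace_exponent lam (\<beta> + b) - laplace_exponent lam b" .
qed

section \<open>Rows of the jump matrix\<close>

lemma measure_lam_pos: "0 < measure lam UNIV"
  using measure_lam_one_pos lam.finite_measure_mono[of "{1}" UNIV] by simp

text \<open>Row \<open>k\<close> charges only columns up to \<open>k + 1\<close> and
  \<open>F\<close> kills the negative ones, so the sum over all integers is finite.\<close>

lemma has_sum_jump_matrix: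
  assumes F: "\<And>m. m < 0 \<Longrightarrow> F m = 0"
  shows "((\<lambda>m. jump_matrix lam (int k) m * F m) has_sum
    ((measure lam {1} * F (int k + 1) + (\<Sum>l\<le>k. neg_mass l * F (int k - int l))) / measure lam UNIV)) UNIV"
proof -
  let ?f = "\<lambda>m. jump_matrix lam (int k) m * F m"
  have "(?f has_sum sum ?f {0..int k + 1}) {0..int k + 1}" by (rule has_sum_finite) simp
  moreover have zero: "?f m = 0" if "m \<notin> {0..int k + 1}" for m
  proof (cases "m < 0")
    case False
    with that have "2 \<le> m - int k" by auto
    then show ?thesis using measure_lam_ge2[of "m - int k"] by (simp add: jump_matrix_def)
  qed (simp add: F)
  moreover have "(?f has_sum x) {0..int k + 1} \<longleftrightarrow> (?f has_sum x) UNIV" for x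
    by (rule has_sum_cong_neutral) (rule zero, simp_all)
  ultimately have "(?f has_sum sum ?f {0..int k + 1}) UNIV" by blast
  moreover have "sum ?f {0..int k + 1} = ?f (int k + 1) + sum ?f {0..int k}"
  proof -
    have "{0..int k + 1} = insert (int k + 1) {0..int k}" by auto
    then show ?thesis by simp
  qed
  moreover have "sum ?f {0..int k} = (\<Sum>l\<le>k. ?f (int k - int l))"
    by (rule sum.reindex_bij_witness[of _ "\<lambda>l. int k - int l" "\<lambda>m. nat (int k - m)"]) auto
  ultimately show ?thesis
    by (simp add: jump_matrix_def add_divide_distrib sum_divide_distrib)
qed

lemma has_sum_jump_matrix_one: "((\<lambda>m. jump_matrix lam (int k) m) has_sum 1) UNIV"
proof -
  let ?f = "\<lambda>m. jump_matrix lam (int k) m" and ?g = "measure lam UNIV" and ?p = "measure lam {1}"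
  have "(neg_mass has_sum (?g - ?p)) UNIV"
    using measure_lam_sums by (rule sums_nonneg_imp_has_sum) simp
  from has_sum_cmult_left[OF this, of "1 / ?g"]
  have "((\<lambda>l. ?f (int k - int l)) has_sum ((?g - ?p) / ?g)) UNIV"
    by (simp add: jump_matrix_def)
  then have 1: "(?f has_sum ((?g - ?p) / ?g)) {..int k}"
    by (rule has_sum_reindex_bij_betw[THEN iffD1, rotated])
       (rule bij_betw_byWitness[where f'="\<lambda>m. nat (int k - m)"], auto)
  have 2: "(?f has_sum ?p / ?g) {int k + 1}"
    using has_sum_finite[of "{int k + 1}" ?f] by (simp add: jump_matrix_def)
  have "(?f has_sum ((?g - ?p) / ?g + ?p / ?g)) ({..int k} \<union> {int k + 1})"
    using 1 2 by (rule has_sum_Un_disjoint) auto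
  moreover have zero: "?f m = 0" if "m \<notin> {..int k} \<union> {int k + 1}" for m
  proof -
    from that have "2 \<le> m - int k" by auto
    then show ?thesis using measure_lam_ge2[of "m - int k"] by (simp add: jump_matrix_def)
  qed
  moreover have "(?f has_sum x) ({..int k} \<union> {int k + 1}) \<longleftrightarrow> (?f has_sum x) UNIV" for x
    by (rule has_sum_cong_neutral) (rule zero, simp_all)
  ultimately have "(?f has_sum ((?g - ?p) / ?g + ?p / ?g)) UNIV" by blast
  then show ?thesis using measure_lam_pos by (simp add: diff_divide_distrib)
qed

end

section \<open>Recursions for the scale functions\<close>

text \<open>The tilted chain has atoms \<open>exp (b * x) * measure lam {x}\<close> and total mass
  increased by \<open>q\<close>. Multiplying its recursion by
  \<open>exp (b * k) / measure lam {1}\<close> absorbs every exponential and leaves a recursion in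
  \<open>lam\<close> itself.\<close>

lemma scale_W_recursion:
  fixes M :: "'a measure" and N :: "'b measure"
  assumes "usf_levy_chain M X lam" and q: "0 \<le> q" and "usf_levy_chain N Y (tilt (Phi lam q) lam)"
  obtains w :: "nat \<Rightarrow> real"
  where "w 0 = 1 / measure lam {1}"
    and "\<And>k. (measure lam UNIV + q) * w k = measure lam {1} * w (Suc k) + (\<Sum>l\<le>k. measure lam {- real l} * w (k - l))"
    and "\<And>x. 0 \<le> x \<Longrightarrow> scale_W N Y lam q x = w (nat \<lfloor>x\<rfloor>)"
proof -
  interpret chain: usf_levy_chain M X lam by fact
  interpret tilted: usf_levy_chain N Y "tilt (Phi lam q) lam" by fact
  define b where "b = Phi lam q"
  let ?p = "measure lam {1}" and ?g = "measure lam UNIV" and ?m = "\<lambda>l::nat. measure lam {- real l}"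
  have b: "0 \<le> b" "largest_root lam \<le> b" "laplace_exponent lam b = q"
    using chain.Phi_ge[OF q] chain.laplace_exponent_Phi[OF q] chain.largest_root_nonneg by (auto simp: b_def)
  define s where "s = tilted.scale_seq"
  \<comment> \<open>One factor \<open>exp b\<close> of the prefactor
    \<open>exp (b * (k + 1))\<close> cancels against the normalizing constant
    \<open>1 / (exp b * ?p)\<close> of the tilted chain.\<close>
  define w where "w k = exp (b * real k) * s k / ?p" for k
  \<comment> \<open>\<open>b\<close> is at or beyond the largest root, where the exponent increases
    strictly.\<close>
  have pos: "0 < laplace_exponent (tilt b lam) \<beta>" if "0 < \<beta>" for \<beta>
    using chain.laplace_exponent_strict_mono[of b "\<beta> + b"] b that
    by (simp add: chain.laplace_exponent_tilt)
  have s_rec: "exp b * ?p * s (Suc k) = (?g + q) * s k - (\<Sum>l\<le>k. exp (b * - real l) * ?m l * s (k - l))" for k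
  proof -
    have "measure (tilt b lam) {1} * s (Suc k) = measure (tilt b lam) UNIV * s k
        - (\<Sum>l\<le>k. measure (tilt b lam) {- real l} * s (k - l))"
      unfolding s_def b_def by (rule renewal_seq_rec) (use tilted.measure_lam_one_pos in simp)
    then show ?thesis
      unfolding chain.measure_tilt_singleton chain.measure_tilt_UNIV[OF b(1)] b(3) by simp
  qed
  show thesis
  proof
    show "w 0 = 1 / ?p" by (simp add: w_def s_def)
    show "(?g + q) * w k = ?p * w (Suc k) + (\<Sum>l\<le>k. ?m l * w (k - l))" for k
    proof -
      have "?p * w (Suc k) = exp (b * real k) / ?p * (exp b * ?p * s (Suc k))"
        by (simp add: w_def exp_add[symmetric] algebra_simps)
      also have "\<dots> = (?g + q) * w k - (\<Sum>l\<le>k. exp (b * real k) / ?p * (exp (b * - real l) * ?m l * s (k - l)))"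
        unfolding s_rec right_diff_distrib sum_distrib_left by (simp add: w_def)
      also have "(\<Sum>l\<le>k. exp (b * real k) / ?p * (exp (b * - real l) * ?m l * s (k - l))) = (\<Sum>l\<le>k. ?m l * w (k - l))"
      proof (rule sum.cong)
        fix l assume "l \<in> {..k}"
        then have "exp (b * real (k - l)) = exp (b * real k) * exp (b * - real l)"
          by (simp add: exp_add[symmetric] of_nat_diff algebra_simps)
        then show "exp (b * real k) / ?p * (exp (b * - real l) * ?m l * s (k - l)) = ?m l * w (k - l)"
          by (simp add: w_def)
      qed simp
      finally show ?thesis by simp
    qed
    fix x :: real assume x: "0 \<le> x"
    have "scale_function N Y (tilt b lam) x = s (nat \<lfloor>x\<rfloor>) / measure (tilt b lam) {1}"
      unfolding s_def b_def by (rule tilted.scale_function_eq) (use pos in \<open>simp add: b_def\<close>)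
    moreover have "exp (b * of_int \<lfloor>1 + x\<rfloor>) = exp b * exp (b * real (nat \<lfloor>x\<rfloor>))"
      using x by (simp add: exp_add[symmetric] algebra_simps)
    ultimately show "scale_W N Y lam q x = w (nat \<lfloor>x\<rfloor>)"
      using x by (simp add: scale_W_def w_def b_def[symmetric] chain.measure_tilt_singleton)
  qed
qed

lemma scale_Z_of_nat:
  assumes "\<And>x. 0 \<le> x \<Longrightarrow> scale_W N Y lam q x = w (nat \<lfloor>x\<rfloor>)"
  shows "scale_Z N Y lam q (real k) = 1 + q * (\<Sum>j<k. w j)"
proof -
  have "((\<lambda>x. 1) has_integral (1::real)) {real j..real (Suc j)}" for j
    using has_integral_const_real[of "1::real" "real j" "real (Suc j)"] by simp
  from has_integral_step[OF this, of w k]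
  have "((\<lambda>x. w (nat \<lfloor>x\<rfloor>)) has_integral (\<Sum>j<k. w j)) {0..real k}" by simp
  then have "(scale_W N Y lam q has_integral (\<Sum>j<k. w j)) {0..real k}"
    by (rule has_integral_eq[rotated]) (use assms in simp)
  then show ?thesis by (simp add: scale_Z_def integral_unique)
qed

text \<open>The recursion summed over indices below \<open>k\<close>; the constant 1 is
  \<open>p * w 0\<close>, the term missing from the shifted sum.\<close>

lemma partial_sums_recursion:
  fixes w :: "nat \<Rightarrow> real"
  assumes "p * w 0 = 1" and rec: "\<And>k. g * w k = p * w (Suc k) + (\<Sum>l\<le>k. m l * w (k - l))"
  shows "p * (\<Sum>j<Suc k. w j) + (\<Sum>l\<le>k. m l * (\<Sum>j<k - l. w j)) = 1 + g * (\<Sum>j<k. w j)"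
proof (induction k)
  case 0
  then show ?case using assms(1) by simp
next
  case (Suc k)
  have "(\<Sum>l\<le>Suc k. m l * (\<Sum>j<Suc k - l. w j)) = (\<Sum>l\<le>k. m l * (\<Sum>j<k - l. w j) + m l * w (k - l))"
    by (simp, rule sum.cong) (auto simp: Suc_diff_le algebra_simps)
  then show ?case using Suc.IH rec[of k] by (simp add: sum.distrib algebra_simps)
qed

theorem proposition4p14:
  fixes M :: "'a measure" and X :: "real \<Rightarrow> 'a \<Rightarrow> real" and lam :: "real measure"
    and N :: "'b measure" and Y :: "real \<Rightarrow> 'b \<Rightarrow> real" and q :: real
  assumes X: "usf_levy_chain M X lam"
    and q: "0 \<le> q"
    and Y: "usf_levy_chain N Y (tilt (Phi lam q) lam)"
  shows "let W = scale_W N Y lam q; Z = scale_Z N Y lam q; P = jump_matrix lam;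
             \<gamma> = measure lam UNIV; lam\<^sub>q = 1 + q / \<gamma>; p = measure lam {1} / \<gamma>;
             ql = (\<lambda>l::nat. measure lam {- real l} / \<gamma>)
         in (\<forall>k::int. 0 \<le> k \<longrightarrow>
               ((\<lambda>m::int. P k m * W (real_of_int m)) has_sum lam\<^sub>q * W (real_of_int k)) UNIV) \<and>
            (\<forall>k::int. 0 \<le> k \<longrightarrow>
               ((\<lambda>m::int. P k m * Z (real_of_int m)) has_sum lam\<^sub>q * Z (real_of_int k)) UNIV) \<and>
            (\<forall>k::nat. p * W (real k + 1) =
               (1 + q / \<gamma>) * W (real k) - (\<Sum>l = 1..k. ql l * W (real k - real l))) \<and>
            (\<forall>k::nat. p * Z (real k + 1) + (1 - p - (\<Sum>l\<in>{1..<k}. ql l)) =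
               (1 + q / \<gamma>) * Z (real k) - (\<Sum>l\<in>{1..<k}. ql l * Z (real k - real l))) \<and>
            (\<forall>k::int. k < 0 \<longrightarrow> W (real_of_int k) = 0) \<and>
            W 0 = 1 / measure lam {1} \<and>
            (\<forall>k::int. k \<le> 0 \<longrightarrow> Z (real_of_int k) = 1)"
proof -
  interpret chain: usf_levy_chain M X lam by (rule X)
  let ?W = "scale_W N Y lam q" and ?Z = "scale_Z N Y lam q"
  let ?p = "measure lam {1}" and ?g = "measure lam UNIV" and ?m = "\<lambda>l::nat. measure lam {- real l}"
  have g: "0 < ?g" and p: "0 < ?p" by (fact chain.measure_lam_pos chain.measure_lam_one_pos)+
  obtain w where w0: "w 0 = 1 / ?p"
    and w_rec: "\<And>k. (?g + q) * w k = ?p * w (Suc k) + (\<Sum>l\<le>k. ?m l * w (k - l))"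
    and W: "\<And>x. 0 \<le> x \<Longrightarrow> ?W x = w (nat \<lfloor>x\<rfloor>)"
    using scale_W_recursion[OF X q Y] by blast
  define z where "z k = 1 + q * (\<Sum>j<k. w j)" for k
  have W_nat: "?W (real k) = w k" for k by (simp add: W)
  have W_neg: "x < 0 \<Longrightarrow> ?W x = 0" for x by (simp add: scale_W_def)
  have Z_nat: "?Z (real k) = z k" for k unfolding z_def using W by (rule scale_Z_of_nat)
  have Z_neg: "x < 0 \<Longrightarrow> ?Z x = 1" for x by (simp add: scale_Z_def)
  have W_diff: "?W (real k - real l) = w (k - l)" and Z_diff: "?Z (real k - real l) = z (k - l)" if "l \<le> k" for k l
    using W_nat[of "k - l"] Z_nat[of "k - l"] that by (simp_all add: of_nat_diff)
  \<comment> \<open>Multiplication by \<open>q\<close> turns the partial sums into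
    \<open>z - 1\<close>, also when \<open>q = 0\<close>; then
    \<open>q + (?g + q) * (z k - 1) + ?g = (?g + q) * z k\<close>.\<close>
  have z_rec: "?p * (z (Suc k) - 1) + (\<Sum>l\<le>k. ?m l * (z (k - l) - 1)) + ?g = (?g + q) * z k" for k
  proof -
    have "?p * (\<Sum>j<Suc k. w j) + (\<Sum>l\<le>k. ?m l * (\<Sum>j<k - l. w j)) = 1 + (?g + q) * (\<Sum>j<k. w j)"
      by (rule partial_sums_recursion[OF _ w_rec]) (use w0 p in simp)
    then have "q * (?p * (\<Sum>j<Suc k. w j) + (\<Sum>l\<le>k. ?m l * (\<Sum>j<k - l. w j))) = q * (1 + (?g + q) * (\<Sum>j<k. w j))"
      by (rule arg_cong)
    then have "?p * (q * (\<Sum>j<Suc k. w j)) + (\<Sum>l\<le>k. ?m l * (q * (\<Sum>j<k - l. w j))) = q + (?g + q) * (q * (\<Sum>j<k. w j))"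
      by (simp only: distrib_left sum_distrib_left mult.left_commute[of q] mult_1_right)
    then show ?thesis by (simp add: z_def algebra_simps)
  qed
  have z_rec': "(?p * (z (Suc k) - 1) + (\<Sum>l\<le>k. ?m l * (z (k - l) - 1))) / ?g + 1 = (1 + q / ?g) * z k" for k
  proof -
    have "A / ?g + 1 = (1 + q / ?g) * x" if "A + ?g = (?g + q) * x" for A x
      using that g by (simp add: field_simps)
    then show ?thesis using z_rec by blast
  qed
  have W_eq: "?p / ?g * ?W (real k + 1) = (1 + q / ?g) * ?W (real k) - (\<Sum>l = 1..k. ?m l / ?g * ?W (real k - real l))" for k
  proof -
    have "(\<Sum>l = 1..k. ?m l / ?g * ?W (real k - real l)) = (\<Sum>l = 1..k. ?m l * w (k - l)) / ?g"
      unfolding sum_divide_distrib by (intro sum.cong) (simp_all add: W_diff)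
    also have "(\<Sum>l = 1..k. ?m l * w (k - l)) = (\<Sum>l\<le>k. ?m l * w (k - l))"
      by (rule sum.mono_neutral_left) (auto simp: chain.measure_lam_zero not_le)
    finally have S: "(\<Sum>l = 1..k. ?m l / ?g * ?W (real k - real l)) = (\<Sum>l\<le>k. ?m l * w (k - l)) / ?g" .
    have "?W (real k + 1) = w (Suc k)" using W_nat[of "Suc k"] by (simp add: add.commute)
    then show ?thesis
      unfolding S W_nat using w_rec[of k] g by (simp add: field_simps)
  qed
  have Z_eq: "?p / ?g * ?Z (real k + 1) + (1 - ?p / ?g - (\<Sum>l\<in>{1..<k}. ?m l / ?g))
      = (1 + q / ?g) * ?Z (real k) - (\<Sum>l\<in>{1..<k}. ?m l / ?g * ?Z (real k - real l))" for k
  proof -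
    have "(\<Sum>l\<in>{1..<k}. ?m l / ?g * ?Z (real k - real l)) - (\<Sum>l\<in>{1..<k}. ?m l / ?g)
        = (\<Sum>l\<in>{1..<k}. ?m l * (z (k - l) - 1)) / ?g"
      unfolding sum_divide_distrib sum_subtractf[symmetric]
      by (intro sum.cong) (simp_all add: Z_diff diff_divide_distrib right_diff_distrib)
    \<comment> \<open>The end terms vanish: \<open>lam\<close> has no mass at 0, and
      \<open>z 0 = 1\<close> removes \<open>l = k\<close>. This is why the sum for \<open>Z\<close>
      stops at \<open>k - 1\<close> and the one for \<open>W\<close> at \<open>k\<close>.\<close>
    also have "(\<Sum>l\<in>{1..<k}. ?m l * (z (k - l) - 1)) = (\<Sum>l\<le>k. ?m l * (z (k - l) - 1))"
      by (rule sum.mono_neutral_left) (auto simp: chain.measure_lam_zero z_def not_le not_less le_less_Suc_eq)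
    finally have S: "(\<Sum>l\<in>{1..<k}. ?m l / ?g * ?Z (real k - real l)) - (\<Sum>l\<in>{1..<k}. ?m l / ?g)
        = (\<Sum>l\<le>k. ?m l * (z (k - l) - 1)) / ?g" .
    have "?Z (real k + 1) = z (Suc k)" using Z_nat[of "Suc k"] by (simp add: add.commute)
    moreover have "?p / ?g * (z (Suc k) - 1) + (\<Sum>l\<le>k. ?m l * (z (k - l) - 1)) / ?g + 1 = (1 + q / ?g) * z k"
      using z_rec'[of k] by (simp add: add_divide_distrib)
    ultimately show ?thesis
      unfolding Z_nat using S by (simp add: right_diff_distrib)
  qed
  have W_sum: "((\<lambda>m. jump_matrix lam (int k) m * ?W (of_int m)) has_sum (1 + q / ?g) * w k) UNIV" for k
  proof -
    have "((\<lambda>m. jump_matrix lam (int k) m * ?W (of_int m)) has_sum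
       ((?p * ?W (of_int (int k + 1)) + (\<Sum>l\<le>k. ?m l * ?W (of_int (int k - int l)))) / ?g)) UNIV"
      by (rule chain.has_sum_jump_matrix) (simp add: W_neg)
    also have "(\<Sum>l\<le>k. ?m l * ?W (of_int (int k - int l))) = (\<Sum>l\<le>k. ?m l * w (k - l))"
      by (intro sum.cong) (simp_all add: W_diff)
    also have "?W (of_int (int k + 1)) = w (Suc k)"
      using W_nat[of "Suc k"] by (simp add: add.commute)
    also have "(?p * w (Suc k) + (\<Sum>l\<le>k. ?m l * w (k - l))) / ?g = (1 + q / ?g) * w k"
      unfolding w_rec[symmetric] using g by (simp add: field_simps)
    finally show ?thesis .
  qed
  have Z_sum: "((\<lambda>m. jump_matrix lam (int k) m * ?Z (of_int m)) has_sum (1 + q / ?g) * z k) UNIV" for k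
  proof -
    \<comment> \<open>\<open>Z\<close> equals 1 rather than 0 on the negatives, so the finite
      formula is applied to \<open>Z - 1\<close>; the constant is restored because each row sums to
      1.\<close>
    have "((\<lambda>m. jump_matrix lam (int k) m * (?Z (of_int m) - 1)) has_sum
       ((?p * (?Z (of_int (int k + 1)) - 1) + (\<Sum>l\<le>k. ?m l * (?Z (of_int (int k - int l)) - 1))) / ?g)) UNIV"
      by (rule chain.has_sum_jump_matrix) (simp add: Z_neg)
    from has_sum_add[OF this chain.has_sum_jump_matrix_one[of k]]
    have "((\<lambda>m. jump_matrix lam (int k) m * ?Z (of_int m)) has_sum
       ((?p * (?Z (of_int (int k + 1)) - 1) + (\<Sum>l\<le>k. ?m l * (?Z (of_int (int k - int l)) - 1))) / ?g + 1)) UNIV"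
      by (simp add: right_diff_distrib)
    also have "(\<Sum>l\<le>k. ?m l * (?Z (of_int (int k - int l)) - 1)) = (\<Sum>l\<le>k. ?m l * (z (k - l) - 1))"
      by (intro sum.cong) (simp_all add: Z_diff)
    also have "?Z (of_int (int k + 1)) = z (Suc k)"
      using Z_nat[of "Suc k"] by (simp add: add.commute)
    also have "(?p * (z (Suc k) - 1) + (\<Sum>l\<le>k. ?m l * (z (k - l) - 1))) / ?g + 1 = (1 + q / ?g) * z k"
      by (rule z_rec')
    finally show ?thesis .
  qed
  have "((\<lambda>m. jump_matrix lam k m * ?W (of_int m)) has_sum (1 + q / ?g) * ?W (of_int k)) UNIV"
    and "((\<lambda>m. jump_matrix lam k m * ?Z (of_int m)) has_sum (1 + q / ?g) * ?Z (of_int k)) UNIV"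
    if "0 \<le> k" for k
    using W_sum[of "nat k"] Z_sum[of "nat k"] W_nat[of "nat k"] Z_nat[of "nat k"] that by simp_all
  moreover have "?W 0 = 1 / ?p" using W_nat[of 0] w0 by simp
  moreover have "?Z (of_int k) = 1" if "k \<le> 0" for k :: int
    using Z_nat[of 0] Z_neg[of "of_int k"] that by (cases "k = 0") (auto simp: z_def)
  ultimately show ?thesis
    unfolding Let_def using W_eq Z_eq W_neg by (intro conjI allI impI) auto
qed

end
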